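(* (Working in ZF.) Let $\mathcal L$ be a relational language, let $A$ be an $\mathcal L$-structure whose underlying set admits a linear ordering, and let $B$ be an $\mathcal L$-structure with the pigeonhole property which has at least one relation that is not trivialised by any linear order on $B$. Suppose $[A]^B \neq \emptyset$. Then $A \not\rightarrow (B)^B$.
   Context: For $\mathcal L$-structures $X,Y$, $[X]^Y$ is the set of substructures of $X$ (with induced relations) isomorphic to $Y$. $A \rightarrow (B)^B$ means: for every $F : [A]^B \to \{0,1\}$ there is $H \in [A]^B$ with $F$ constant on $[H]^B$; $\not\rightarrow$ is its negation, and the notation is only used when $[A]^B \ne \emptyset$. $B$ has the pigeonhole property if whenever the underlying set of $B$ is partitioned into finitely many pieces $B_0 \cup \dots \cup B_n$, some $B_m$ (with the induced structure) is isomorphic to $B$. A relation $r$ of arity $n$ on $B$ is trivialised by a linear order $<$ on $B$ if for all $b_0 < b_1 < \dots < b_{n-1}$ and $b'_0 < \dots < b'_{n-1}$ in $B$, $B \models r(b_0,\dots,b_{n-1})$ iff $B \models r(b'_0,\dots,b'_{n-1})$. *)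

theory Defs
  imports Main
begin

text \<open>
  HOL proves the axiom of choice for its own sets, and under choice the linear ordering of the
  structure \<open>A\<close> comes for free.  To speak about ZF without choice, the mathematics below is therefore
  interpreted inside an arbitrary model of ZF: a type with a binary relation satisfying the
  first-order axioms of ZF.  A sentence of set theory is a theorem of ZF iff it holds
  in all such models.

  Every object of the theory (structure, tuple, isomorphism, colouring, linear order, natural number)
  is an element of the model, and all quantifiers range over the model.  In particular
  arities, tuples and finite partitions are those of the model, whose natural numbers may be
  nonstandard.
\<close>

text \<open>Formulas of the language of set theory, with variables named by natural numbers.\<close>

datatype fm = Mem nat nat | Equ nat nat | Neg fm | Conj fm fm | Forall nat fm

locale universe =
  fixes mem :: "'v \<Rightarrow> 'v \<Rightarrow> bool"  (infix "\<^bold>\<in>" 50)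
begin

primrec sat :: "fm \<Rightarrow> (nat \<Rightarrow> 'v) \<Rightarrow> bool" where
  "sat (Mem i j) e \<longleftrightarrow> e i \<^bold>\<in> e j"
| "sat (Equ i j) e \<longleftrightarrow> e i = e j"
| "sat (Neg p) e \<longleftrightarrow> \<not> sat p e"
| "sat (Conj p q) e \<longleftrightarrow> sat p e \<and> sat q e"
| "sat (Forall i p) e \<longleftrightarrow> (\<forall>x. sat p (e(i := x)))"


subsection \<open>Sets, pairs, functions and natural numbers of the model\<close>

definition sub :: "'v \<Rightarrow> 'v \<Rightarrow> bool" where
  "sub x y \<longleftrightarrow> (\<forall>z. z \<^bold>\<in> x \<longrightarrow> z \<^bold>\<in> y)"

definition is_empty :: "'v \<Rightarrow> bool" where
  "is_empty x \<longleftrightarrow> (\<forall>z. \<not> z \<^bold>\<in> x)"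

definition is_upair :: "'v \<Rightarrow> 'v \<Rightarrow> 'v \<Rightarrow> bool" where
  "is_upair x y u \<longleftrightarrow> (\<forall>z. z \<^bold>\<in> u \<longleftrightarrow> z = x \<or> z = y)"

text \<open>Kuratowski pairs.\<close>

definition is_pair :: "'v \<Rightarrow> 'v \<Rightarrow> 'v \<Rightarrow> bool" where
  "is_pair x y p \<longleftrightarrow> (\<exists>u v. is_upair x x u \<and> is_upair x y v \<and> is_upair u v p)"

text \<open>\<open>holds r x y\<close>: the ordered pair of \<open>x\<close> and \<open>y\<close> belongs to \<open>r\<close>;
  when \<open>r\<close> is a function, its value at \<open>x\<close> is \<open>y\<close>.\<close>

definition holds :: "'v \<Rightarrow> 'v \<Rightarrow> 'v \<Rightarrow> bool" where
  "holds r x y \<longleftrightarrow> (\<exists>p. is_pair x y p \<and> p \<^bold>\<in> r)"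

definition function_on :: "'v \<Rightarrow> 'v \<Rightarrow> bool" where
  "function_on f X \<longleftrightarrow>
     (\<forall>p. p \<^bold>\<in> f \<longrightarrow> (\<exists>x y. x \<^bold>\<in> X \<and> is_pair x y p)) \<and>
     (\<forall>x. x \<^bold>\<in> X \<longrightarrow> (\<exists>!y. holds f x y))"

definition function_from_to :: "'v \<Rightarrow> 'v \<Rightarrow> 'v \<Rightarrow> bool" where
  "function_from_to f X Y \<longleftrightarrow> function_on f X \<and> (\<forall>x y. holds f x y \<longrightarrow> y \<^bold>\<in> Y)"

definition bijection :: "'v \<Rightarrow> 'v \<Rightarrow> 'v \<Rightarrow> bool" where
  "bijection f X Y \<longleftrightarrow>
     function_from_to f X Y \<and> (\<forall>y. y \<^bold>\<in> Y \<longrightarrow> (\<exists>!x. holds f x y))"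

definition is_succ :: "'v \<Rightarrow> 'v \<Rightarrow> bool" where
  "is_succ x y \<longleftrightarrow> (\<forall>z. z \<^bold>\<in> y \<longleftrightarrow> z \<^bold>\<in> x \<or> z = x)"

definition is_inductive :: "'v \<Rightarrow> bool" where
  "is_inductive w \<longleftrightarrow>
     (\<exists>z. is_empty z \<and> z \<^bold>\<in> w) \<and> (\<forall>x y. x \<^bold>\<in> w \<and> is_succ x y \<longrightarrow> y \<^bold>\<in> w)"

text \<open>The von Neumann naturals: each is the set of its predecessors, so that a tuple of length \<open>n\<close> is a
  function with domain \<open>n\<close> and the order of indices is membership.\<close>

definition natural :: "'v \<Rightarrow> bool" where
  "natural n \<longleftrightarrow> (\<forall>w. is_inductive w \<longrightarrow> n \<^bold>\<in> w)"


subsection \<open>The axioms of ZF\<close>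

text \<open>In the two schemata the environment \<open>e\<close> supplies the parameters of the formula \<open>p\<close>.\<close>

definition ZF :: bool where
  "ZF \<longleftrightarrow>
     \<comment> \<open>extensionality\<close>
     (\<forall>x y. (\<forall>z. z \<^bold>\<in> x \<longleftrightarrow> z \<^bold>\<in> y) \<longrightarrow> x = y) \<and>
     \<comment> \<open>foundation\<close>
     (\<forall>x. (\<exists>y. y \<^bold>\<in> x) \<longrightarrow> (\<exists>y. y \<^bold>\<in> x \<and> \<not> (\<exists>z. z \<^bold>\<in> x \<and> z \<^bold>\<in> y))) \<and>
     \<comment> \<open>pairing\<close>
     (\<forall>x y. \<exists>u. is_upair x y u) \<and>
     \<comment> \<open>union\<close>
     (\<forall>x. \<exists>u. \<forall>z. z \<^bold>\<in> u \<longleftrightarrow> (\<exists>y. z \<^bold>\<in> y \<and> y \<^bold>\<in> x)) \<and>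
     \<comment> \<open>power set\<close>
     (\<forall>x. \<exists>u. \<forall>z. z \<^bold>\<in> u \<longleftrightarrow> sub z x) \<and>
     \<comment> \<open>infinity\<close>
     (\<exists>w. is_inductive w) \<and>
     \<comment> \<open>separation\<close>
     (\<forall>p e x. \<exists>u. \<forall>z. z \<^bold>\<in> u \<longleftrightarrow> z \<^bold>\<in> x \<and> sat p (e(0 := z))) \<and>
     \<comment> \<open>replacement\<close>
     (\<forall>p e x.
        (\<forall>z. z \<^bold>\<in> x \<longrightarrow>
          (\<forall>y y'. sat p (e(0 := z, 1 := y)) \<and> sat p (e(0 := z, 1 := y')) \<longrightarrow> y = y')) \<longrightarrow>
        (\<exists>u. \<forall>y. y \<^bold>\<in> u \<longleftrightarrow> (\<exists>z. z \<^bold>\<in> x \<and> sat p (e(0 := z, 1 := y)))))"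


subsection \<open>Relational structures\<close>

text \<open>A relational language is a set \<open>L\<close> of relation symbols with an arity function \<open>ar\<close>.\<close>

definition rel_language :: "'v \<Rightarrow> 'v \<Rightarrow> bool" where
  "rel_language L ar \<longleftrightarrow> function_on ar L \<and> (\<forall>R n. holds ar R n \<longrightarrow> natural n)"

text \<open>A structure consists of its underlying set \<open>X\<close> and a function \<open>I\<close> assigning to every symbol
  of arity \<open>n\<close> a set of \<open>n\<close>-tuples over \<open>X\<close>.\<close>

definition rel_structure :: "'v \<Rightarrow> 'v \<Rightarrow> 'v \<Rightarrow> 'v \<Rightarrow> bool" where
  "rel_structure L ar X I \<longleftrightarrow>
     function_on I L \<and>
     (\<forall>R n r. holds ar R n \<and> holds I R r \<longrightarrow>
        (\<forall>t. t \<^bold>\<in> r \<longrightarrow> function_from_to t n X))"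

text \<open>\<open>I\<close> and \<open>J\<close> may interpret the symbols on larger sets than \<open>X\<close> and \<open>Y\<close>.  Only tuples
  over \<open>X\<close> and over \<open>Y\<close> are compared, so this is isomorphism of the structures induced on
  \<open>X\<close> and on \<open>Y\<close>.  The tuple \<open>s\<close> is the composition of \<open>f\<close> with \<open>t\<close>.\<close>

definition isomorphic :: "'v \<Rightarrow> 'v \<Rightarrow> 'v \<Rightarrow> 'v \<Rightarrow> 'v \<Rightarrow> 'v \<Rightarrow> bool" where
  "isomorphic L ar X I Y J \<longleftrightarrow>
     (\<exists>f. bijection f X Y \<and>
       (\<forall>R n r r'. R \<^bold>\<in> L \<and> holds ar R n \<and> holds I R r \<and> holds J R r' \<longrightarrow>
         (\<forall>t s. function_from_to t n X \<and> function_from_to s n Y \<and>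
            (\<forall>i x y. holds t i x \<and> holds f x y \<longrightarrow> holds s i y) \<longrightarrow>
            (t \<^bold>\<in> r \<longleftrightarrow> s \<^bold>\<in> r'))))"

text \<open>A substructure of a relational structure is determined by its underlying set, which may be any
  subset.  So \<open>[A]\<^sup>B\<close> is rendered as the set of all \<open>H\<close> satisfying \<open>is_copy\<close>.\<close>

definition is_copy :: "'v \<Rightarrow> 'v \<Rightarrow> 'v \<Rightarrow> 'v \<Rightarrow> 'v \<Rightarrow> 'v \<Rightarrow> 'v \<Rightarrow> bool" where
  "is_copy L ar A I B J H \<longleftrightarrow> sub H A \<and> isomorphic L ar H I B J"

definition is_set_of_copies :: "'v \<Rightarrow> 'v \<Rightarrow> 'v \<Rightarrow> 'v \<Rightarrow> 'v \<Rightarrow> 'v \<Rightarrow> 'v \<Rightarrow> bool" where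
  "is_set_of_copies L ar A I B J S \<longleftrightarrow> (\<forall>H. H \<^bold>\<in> S \<longleftrightarrow> is_copy L ar A I B J H)"


subsection \<open>The partition relation\<close>

definition is_two :: "'v \<Rightarrow> bool" where
  "is_two d \<longleftrightarrow> (\<exists>z u. is_empty z \<and> is_succ z u \<and> is_succ u d)"

definition arrows :: "'v \<Rightarrow> 'v \<Rightarrow> 'v \<Rightarrow> 'v \<Rightarrow> 'v \<Rightarrow> 'v \<Rightarrow> bool" where
  "arrows L ar A I B J \<longleftrightarrow>
     (\<forall>S d F. is_set_of_copies L ar A I B J S \<and> is_two d \<and> function_from_to F S d \<longrightarrow>
       (\<exists>H. H \<^bold>\<in> S \<and>
         (\<exists>T. is_set_of_copies L ar H I B J T \<and>
           (\<exists>c. \<forall>K. K \<^bold>\<in> T \<longrightarrow> holds F K c))))"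


subsection \<open>The pigeonhole property\<close>

text \<open>The pieces \<open>P(0), \<dots>, P(n)\<close> are given by a function \<open>P\<close> on the successor \<open>m\<close> of \<open>n\<close>.
  Pieces may be empty; an empty piece is isomorphic to \<open>B\<close> only if \<open>B\<close> is empty.\<close>

definition is_partition :: "'v \<Rightarrow> 'v \<Rightarrow> 'v \<Rightarrow> bool" where
  "is_partition P m X \<longleftrightarrow>
     function_on P m \<and>
     (\<forall>x. x \<^bold>\<in> X \<longleftrightarrow> (\<exists>i Y. holds P i Y \<and> x \<^bold>\<in> Y)) \<and>
     (\<forall>i j Y Z. holds P i Y \<and> holds P j Z \<and> i \<noteq> j \<longrightarrow> \<not> (\<exists>x. x \<^bold>\<in> Y \<and> x \<^bold>\<in> Z))"

definition pigeonhole :: "'v \<Rightarrow> 'v \<Rightarrow> 'v \<Rightarrow> 'v \<Rightarrow> bool" where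
  "pigeonhole L ar B J \<longleftrightarrow>
     (\<forall>n m P. natural n \<and> is_succ n m \<and> is_partition P m B \<longrightarrow>
       (\<exists>i Y. holds P i Y \<and> isomorphic L ar Y J B J))"


subsection \<open>Linear orders and trivialised relations\<close>

text \<open>Strict linear orders.\<close>

definition is_linear_order :: "'v \<Rightarrow> 'v \<Rightarrow> bool" where
  "is_linear_order lt X \<longleftrightarrow>
     (\<forall>p. p \<^bold>\<in> lt \<longrightarrow> (\<exists>x y. x \<^bold>\<in> X \<and> y \<^bold>\<in> X \<and> is_pair x y p)) \<and>
     (\<forall>x. \<not> holds lt x x) \<and>
     (\<forall>x y z. holds lt x y \<and> holds lt y z \<longrightarrow> holds lt x z) \<and>
     (\<forall>x y. x \<^bold>\<in> X \<and> y \<^bold>\<in> X \<longrightarrow> holds lt x y \<or> x = y \<or> holds lt y x)"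

definition increasing_tuple :: "'v \<Rightarrow> 'v \<Rightarrow> 'v \<Rightarrow> 'v \<Rightarrow> bool" where
  "increasing_tuple lt n X t \<longleftrightarrow>
     function_from_to t n X \<and>
     (\<forall>i j x y. i \<^bold>\<in> j \<and> holds t i x \<and> holds t j y \<longrightarrow> holds lt x y)"

definition trivialises :: "'v \<Rightarrow> 'v \<Rightarrow> 'v \<Rightarrow> 'v \<Rightarrow> 'v \<Rightarrow> bool" where
  "trivialises ar X I lt R \<longleftrightarrow>
     (\<forall>n r. holds ar R n \<and> holds I R r \<longrightarrow>
       (\<forall>t s. increasing_tuple lt n X t \<and> increasing_tuple lt n X s \<longrightarrow> (t \<^bold>\<in> r \<longleftrightarrow> s \<^bold>\<in> r)))"

end

end

theory Submission
  imports Defs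
begin

text \<open>
  Let \<open><\<close> be a linear order of \<open>A\<close>, and call a copy \<open>K\<close> of \<open>B\<close> good if none of its proper initial
  segments \<open>{x \<in> K. x < b}\<close> contains a copy.  If \<open>K\<close> is good, then so are all copies inside \<open>K\<close>, and
  for every increasing tuple \<open>t\<close> in \<open>K\<close> the pigeonhole property makes the entries of \<open>t\<close>, together with
  all larger elements of \<open>K\<close>, a copy: the remaining elements lie below the last entry of \<open>t\<close>.
  So any increasing tuple can be made the initial one, and colouring a good copy by whether its
  initial \<open>n\<close>-tuple satisfies the nontrivial relation is never constant below a good copy.  The same
  works for the reversed order, with final tuples in place of initial ones.

  It remains to colour the copies that are good in neither sense: by whether they have an endpoint.
  Suppose that \<open>K\<close> contains no copy that is good for either order.  If \<open>x < y\<close> in \<open>K\<close>, then one of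
  \<open>{z \<in> K. z < x} \<union> {y}\<close> and its complement is a copy, and both have an endpoint.  The set of all
  \<open>b \<in> K\<close> below which there is a copy is itself a copy, for otherwise its complement would be a good
  one; and it has no least element \<open>m\<close>, for a copy below \<open>m\<close> would be good.  Doing this for both orders
  gives a copy without endpoints.
\<close>

subsection \<open>Definable predicates\<close>

text \<open>
  To apply the schemata without writing down formulas, call a predicate of environments definable if
  some formula expresses it, with finitely many parameters from the model.  Closure under quantifiers
  is stated for de Bruijn style environments, where the bound variable becomes variable 0.
\<close>

primrec rename :: "(nat \<Rightarrow> nat) \<Rightarrow> fm \<Rightarrow> fm" where
  "rename f (Mem i j) = Mem (f i) (f j)"
| "rename f (Equ i j) = Equ (f i) (f j)"
| "rename f (Neg p) = Neg (rename f p)"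
| "rename f (Conj p q) = Conj (rename f p) (rename f q)"
| "rename f (Forall i p) = Forall (f i) (rename f p)"

primrec bound :: "fm \<Rightarrow> nat" where
  "bound (Mem i j) = Suc (max i j)"
| "bound (Equ i j) = Suc (max i j)"
| "bound (Neg p) = bound p"
| "bound (Conj p q) = max (bound p) (bound q)"
| "bound (Forall i p) = max (Suc i) (bound p)"

context universe
begin

lemma sat_cong:
  "(\<And>i. i < bound p \<Longrightarrow> e i = e' i) \<Longrightarrow> sat p e = sat p e'"
proof (induction p arbitrary: e e')
  case (Forall i p)
  have "sat p (e(i := x)) = sat p (e'(i := x))" for x
    by (rule Forall.IH) (simp add: Forall.prems)
  then show ?case by simp
next
  case (Conj p q)
  have "sat p e = sat p e'" "sat q e = sat q e'"
    by (rule Conj.IH; simp add: Conj.prems)+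
  then show ?case by simp
next
  case (Neg p)
  have "sat p e = sat p e'"
    by (rule Neg.IH) (simp add: Neg.prems)
  then show ?case by simp
qed simp_all

text \<open>Quantified variables are renamed together with the free ones, so injectivity on the
  indices below \<open>bound p\<close>, which cover both kinds, is what rules out capture.\<close>

lemma sat_rename:
  "inj_on f {..<bound p} \<Longrightarrow> sat (rename f p) e = sat p (\<lambda>i. e (f i))"
proof (induction p arbitrary: e)
  case (Conj p q)
  have "inj_on f {..<bound p}" "inj_on f {..<bound q}"
    using Conj.prems by (auto elim!: inj_on_subset)
  with Conj.IH show ?case by simp
next
  case (Forall i p)
  have inj: "inj_on f {..<bound p}"
    using Forall.prems by (auto elim!: inj_on_subset)
  have "sat p (\<lambda>k. (e(f i := x)) (f k)) = sat p ((\<lambda>k. e (f k))(i := x))" for x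
    by (rule sat_cong) (use Forall.prems in \<open>auto simp: inj_on_def\<close>)
  then show ?case
    using Forall.IH[OF inj] by simp
qed auto

section \<open>Definability with finitely many parameters, and its closure properties\<close>

definition param_env :: "nat \<Rightarrow> (nat \<Rightarrow> 'v) \<Rightarrow> (nat \<Rightarrow> 'v) \<Rightarrow> nat \<Rightarrow> 'v" where
  "param_env n a e k = (if k < n then a k else e (k - n))"

definition definable :: "((nat \<Rightarrow> 'v) \<Rightarrow> bool) \<Rightarrow> bool" where
  "definable P \<longleftrightarrow> (\<exists>p n a. \<forall>e. sat p (param_env n a e) \<longleftrightarrow> P e)"

text \<open>The language has no function symbols, so a term is a variable or a parameter.\<close>

definition tm :: "((nat \<Rightarrow> 'v) \<Rightarrow> 'v) \<Rightarrow> bool" where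
  "tm T \<longleftrightarrow> (\<exists>i. T = (\<lambda>e. e i)) \<or> (\<exists>c. T = (\<lambda>e. c))"

lemma tm_var: "tm (\<lambda>e. e i)"
  and tm_const: "tm (\<lambda>e. c)"
  by (auto simp: tm_def)

lemma tm_shift: "tm T \<Longrightarrow> tm (\<lambda>e. T (\<lambda>k. e (Suc k)))"
  by (auto simp: tm_def)

text \<open>Slot \<open>m\<close> of the parameter list is reserved for \<open>T\<close>. A constant
  is stored there; a variable leaves the slot free, and any \<open>c\<close> will do.\<close>

lemma tm_param:
  assumes "tm T" "m < (n::nat)"
  obtains c k where "\<And>a e. a m = c \<Longrightarrow> param_env n a e k = T e"
  using assms(1) unfolding tm_def
proof (elim disjE exE)
  fix i assume "T = (\<lambda>e. e i)"
  then show thesis by (intro that[of _ "n + i"]) (simp add: param_env_def)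
next
  fix c assume "T = (\<lambda>e. c)"
  then show thesis using assms(2) by (intro that[of c m]) (simp add: param_env_def)
qed

lemma
  assumes "tm T" "tm U"
  shows definable_mem: "definable (\<lambda>e. T e \<^bold>\<in> U e)"
    and definable_eq: "definable (\<lambda>e. T e = U e)"
proof -
  obtain c k where T: "\<And>a e. a 0 = c \<Longrightarrow> param_env 2 a e k = T e"
    using tm_param[OF assms(1), of 0 2] by auto
  obtain d l where U: "\<And>a e. a 1 = d \<Longrightarrow> param_env 2 a e l = U e"
    using tm_param[OF assms(2), of 1 2] by auto
  define a where "a i = (if i = 0 then c else d)" for i :: nat
  have "param_env 2 a e k = T e" "param_env 2 a e l = U e" for e
    by (auto intro!: T U simp: a_def)
  then have "\<forall>e. sat (Mem k l) (param_env 2 a e) \<longleftrightarrow> T e \<^bold>\<in> U e"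
    "\<forall>e. sat (Equ k l) (param_env 2 a e) \<longleftrightarrow> T e = U e"
    by simp_all
  then show "definable (\<lambda>e. T e \<^bold>\<in> U e)" "definable (\<lambda>e. T e = U e)"
    unfolding definable_def by blast+
qed

lemma definable_not:
  assumes "definable P"
  shows "definable (\<lambda>e. \<not> P e)"
proof -
  obtain p n a where "\<forall>e. sat p (param_env n a e) \<longleftrightarrow> P e"
    using assms unfolding definable_def by blast
  then have "\<forall>e. sat (Neg p) (param_env n a e) \<longleftrightarrow> \<not> P e" by simp
  then show ?thesis unfolding definable_def by blast
qed

lemma definable_conj:
  assumes "definable P" "definable Q"
  shows "definable (\<lambda>e. P e \<and> Q e)"
proof -
  obtain p n a where P: "\<And>e. sat p (param_env n a e) \<longleftrightarrow> P e"
    using assms(1) unfolding definable_def by blast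
  obtain q m b where Q: "\<And>e. sat q (param_env m b e) \<longleftrightarrow> Q e"
    using assms(2) unfolding definable_def by blast
  \<comment> \<open>The parameter lists are concatenated: those of \<open>p\<close> stay in place,
    those of \<open>q\<close> follow, and the proper variables of both formulas start at
    \<open>n + m\<close>.\<close>
  define f where "f k = (if k < n then k else k + m)" for k
  define g where "g k = k + n" for k
  define c where "c k = (if k < n then a k else b (k - n))" for k
  have "inj f" "inj g"
    by (auto simp: inj_on_def f_def g_def)
  then have inj: "inj_on f X" "inj_on g X" for X
    by (auto intro: inj_on_subset)
  have "(\<lambda>k. param_env (n + m) c e (f k)) = param_env n a e"
    "(\<lambda>k. param_env (n + m) c e (g k)) = param_env m b e" for e
    by (auto simp: param_env_def f_def g_def c_def fun_eq_iff)
  then have "sat (Conj (rename f p) (rename g q)) (param_env (n + m) c e) \<longleftrightarrow> P e \<and> Q e" for e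
    by (simp add: sat_rename[OF inj(1)] sat_rename[OF inj(2)] P Q)
  then show ?thesis unfolding definable_def by blast
qed

text \<open>The variable to be quantified is variable 0 of the environment, hence variable
  \<open>n\<close> of the formula. It is renamed to a fresh \<open>m\<close>, and the variables
  above \<open>n\<close> move down by one to close the gap.\<close>

lemma definable_all:
  assumes "definable (\<lambda>e. Q (e 0) (\<lambda>k. e (Suc k)))"
  shows "definable (\<lambda>e. \<forall>x. Q x e)"
proof -
  obtain p n a where P: "\<And>e. sat p (param_env n a e) \<longleftrightarrow> Q (e 0) (\<lambda>k. e (Suc k))"
    using assms unfolding definable_def by blast
  define m where "m = bound p + n"
  define f where "f k = (if k < n then k else if k = n then m else k - 1)" for k
  have inj: "inj_on f {..<bound p}"
    by (auto simp: inj_on_def f_def m_def split: if_splits)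
  have "sat (rename f p) ((param_env n a e)(m := x)) \<longleftrightarrow> Q x e" for x e
  proof -
    have "sat (rename f p) ((param_env n a e)(m := x)) =
        sat p (\<lambda>k. ((param_env n a e)(m := x)) (f k))"
      by (rule sat_rename[OF inj])
    also have "\<dots> = sat p (param_env n a (\<lambda>k. case k of 0 \<Rightarrow> x | Suc k \<Rightarrow> e k))"
      by (rule sat_cong) (auto simp: f_def m_def param_env_def Suc_diff_Suc split: nat.splits intro!: arg_cong[of _ _ e])
    finally show ?thesis by (simp add: P)
  qed
  then have "sat (Forall m (rename f p)) (param_env n a e) \<longleftrightarrow> (\<forall>x. Q x e)" for e
    by simp
  then show ?thesis unfolding definable_def by blast
qed

lemma definable_disj: "definable P \<Longrightarrow> definable Q \<Longrightarrow> definable (\<lambda>e. P e \<or> Q e)"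
  using definable_not[OF definable_conj[OF definable_not definable_not]] by simp

lemma definable_imp: "definable P \<Longrightarrow> definable Q \<Longrightarrow> definable (\<lambda>e. P e \<longrightarrow> Q e)"
  using definable_disj[OF definable_not] unfolding imp_conv_disj .

lemma definable_iff: "definable P \<Longrightarrow> definable Q \<Longrightarrow> definable (\<lambda>e. P e \<longleftrightarrow> Q e)"
  using definable_conj[OF definable_imp definable_imp, of P Q Q P] unfolding iff_conv_conj_imp .

lemma definable_ex:
  assumes "definable (\<lambda>e. Q (e 0) (\<lambda>k. e (Suc k)))"
  shows "definable (\<lambda>e. \<exists>x. Q x e)"
  using definable_not[OF definable_all[OF definable_not[OF assms]]] by simp

lemmas definable_intros =
  definable_not definable_conj definable_disj definable_imp definable_iff
  definable_all definable_ex definable_mem definable_eq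
lemmas tm_intros = tm_var tm_const tm_shift

section \<open>Definability of the set-theoretic notions\<close>

lemma definable_sub:
  "\<lbrakk>tm T; tm U\<rbrakk> \<Longrightarrow> definable (\<lambda>e. sub (T e) (U e))"
  unfolding sub_def by (assumption | rule definable_intros tm_intros)+

lemma definable_is_upair:
  "\<lbrakk>tm T; tm U; tm V\<rbrakk> \<Longrightarrow> definable (\<lambda>e. is_upair (T e) (U e) (V e))"
  unfolding is_upair_def by (assumption | rule definable_intros tm_intros)+

lemma definable_is_pair:
  "\<lbrakk>tm T; tm U; tm V\<rbrakk> \<Longrightarrow> definable (\<lambda>e. is_pair (T e) (U e) (V e))"
  unfolding is_pair_def by (assumption | rule definable_intros definable_is_upair tm_intros)+

lemma definable_holds:
  "\<lbrakk>tm T; tm U; tm V\<rbrakk> \<Longrightarrow> definable (\<lambda>e. holds (T e) (U e) (V e))"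
  unfolding holds_def by (assumption | rule definable_intros definable_is_pair tm_intros)+

lemma definable_function_from_to:
  "\<lbrakk>tm T; tm U; tm V\<rbrakk> \<Longrightarrow> definable (\<lambda>e. function_from_to (T e) (U e) (V e))"
  unfolding function_from_to_def function_on_def Ex1_def
  by (assumption | rule definable_intros definable_is_pair definable_holds tm_intros)+

lemma definable_is_empty:
  "tm T \<Longrightarrow> definable (\<lambda>e. is_empty (T e))"
  unfolding is_empty_def by (assumption | rule definable_intros tm_intros)+

lemmas definable_basic =
  definable_intros definable_sub definable_is_pair definable_holds definable_function_from_to
  definable_is_empty

lemma definable_isomorphic:
  "tm T \<Longrightarrow> definable (\<lambda>e. isomorphic L ar (T e) I Y J)"
  unfolding isomorphic_def bijection_def Ex1_def
  by (assumption | rule definable_basic tm_intros)+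

lemma definable_increasing_tuple:
  "\<lbrakk>tm T; tm U\<rbrakk> \<Longrightarrow> definable (\<lambda>e. increasing_tuple lt n (T e) (U e))"
  unfolding increasing_tuple_def
  by (assumption | rule definable_basic tm_intros)+

end

subsection \<open>Sets and functions of the model\<close>

locale zf_universe = universe +
  assumes zf: ZF
begin

lemma extensionality: "(\<And>z. z \<^bold>\<in> x \<longleftrightarrow> z \<^bold>\<in> y) \<Longrightarrow> x = y"
  using zf unfolding ZF_def by blast

lemma upair_exists: "\<exists>u. is_upair x y u"
  using zf unfolding ZF_def by blast

lemma union_exists: "\<exists>u. \<forall>z. z \<^bold>\<in> u \<longleftrightarrow> (\<exists>y. z \<^bold>\<in> y \<and> y \<^bold>\<in> x)"
  using zf unfolding ZF_def by blast

lemma power_exists: "\<exists>u. \<forall>z. z \<^bold>\<in> u \<longleftrightarrow> sub z x"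
  using zf unfolding ZF_def by blast

lemma inductive_exists: "\<exists>w. is_inductive w"
  using zf unfolding ZF_def by blast

lemma separation:
  assumes "definable (\<lambda>e. P (e 0))"
  shows "\<exists>u. \<forall>z. z \<^bold>\<in> u \<longleftrightarrow> z \<^bold>\<in> x \<and> P z"
proof -
  obtain p n a where P: "\<And>e. sat p (param_env n a e) \<longleftrightarrow> P (e 0)"
    using assms unfolding definable_def by blast
  \<comment> \<open>The axiom tests its element as variable 0, whereas \<open>p\<close> reads it as
    variable \<open>n\<close>, just after the parameters. It is moved to 0, and all other variables
    go up by one to make room.\<close>
  define f where "f k = (if k = n then 0 else Suc k)" for k
  have inj: "inj_on f {..<bound p}"
    by (auto simp: inj_on_def f_def split: if_splits)
  define e where "e k = a (k - 1)" for k
  have "sat (rename f p) (e(0 := z)) \<longleftrightarrow> P z" for z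
  proof -
    have "(\<lambda>k. (e(0 := z)) (f k)) = param_env n a (\<lambda>k. if k = 0 then z else a (k + n))"
      by (auto simp: param_env_def f_def e_def fun_eq_iff)
    then show ?thesis by (simp add: sat_rename[OF inj] P)
  qed
  moreover have "\<exists>u. \<forall>z. z \<^bold>\<in> u \<longleftrightarrow> z \<^bold>\<in> x \<and> sat (rename f p) (e(0 := z))"
    using zf unfolding ZF_def by blast
  ultimately show ?thesis by simp
qed

lemma replacement:
  assumes "definable (\<lambda>e. Q (e 0) (e (Suc 0)))"
    and fn: "\<And>z y y'. \<lbrakk>z \<^bold>\<in> x; Q z y; Q z y'\<rbrakk> \<Longrightarrow> y = y'"
  shows "\<exists>u. \<forall>y. y \<^bold>\<in> u \<longleftrightarrow> (\<exists>z. z \<^bold>\<in> x \<and> Q z y)"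
proof -
  obtain p n a where P: "\<And>e. sat p (param_env n a e) \<longleftrightarrow> Q (e 0) (e (Suc 0))"
    using assms unfolding definable_def by blast
  \<comment> \<open>As for separation, but with two variables to move: the argument \<open>n\<close>
    goes to 0 and the value \<open>n + 1\<close> to 1.\<close>
  define f where "f k = (if k = n then 0 else if k = Suc n then 1 else Suc (Suc k))" for k
  have inj: "inj_on f {..<bound p}"
    by (auto simp: inj_on_def f_def split: if_splits)
  define e where "e k = a (k - 2)" for k
  have Q: "sat (rename f p) (e(0 := z, 1 := y)) \<longleftrightarrow> Q z y" for z y
  proof -
    have "(\<lambda>k. (e(0 := z, 1 := y)) (f k)) =
        param_env n a (\<lambda>k. if k = 0 then z else if k = 1 then y else a (k + n))"
      by (auto simp: param_env_def f_def e_def fun_eq_iff)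
    then show ?thesis by (simp add: sat_rename[OF inj] P)
  qed
  have "\<forall>p e x.
        (\<forall>z. z \<^bold>\<in> x \<longrightarrow>
          (\<forall>y y'. sat p (e(0 := z, 1 := y)) \<and> sat p (e(0 := z, 1 := y')) \<longrightarrow> y = y')) \<longrightarrow>
        (\<exists>u. \<forall>y. y \<^bold>\<in> u \<longleftrightarrow> (\<exists>z. z \<^bold>\<in> x \<and> sat p (e(0 := z, 1 := y))))"
    using zf unfolding ZF_def by blast
  from this[rule_format, of x "rename f p" e] show ?thesis
    unfolding Q using fn by blast
qed

lemma union2_exists: "\<exists>u. \<forall>z. z \<^bold>\<in> u \<longleftrightarrow> z \<^bold>\<in> x \<or> z \<^bold>\<in> y"
proof -
  obtain v where v: "is_upair x y v" using upair_exists by blast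
  obtain u where "\<forall>z. z \<^bold>\<in> u \<longleftrightarrow> (\<exists>y. z \<^bold>\<in> y \<and> y \<^bold>\<in> v)" using union_exists by blast
  then have "\<forall>z. z \<^bold>\<in> u \<longleftrightarrow> z \<^bold>\<in> x \<or> z \<^bold>\<in> y" using v by (auto simp: is_upair_def)
  then show ?thesis by blast
qed

lemma succ_exists: "\<exists>y. is_succ x y"
proof -
  obtain v where v: "is_upair x x v" using upair_exists by blast
  obtain u where "\<forall>z. z \<^bold>\<in> u \<longleftrightarrow> z \<^bold>\<in> x \<or> z \<^bold>\<in> v" using union2_exists by blast
  then have "is_succ x u" using v by (auto simp: is_upair_def is_succ_def)
  then show ?thesis by blast
qed

lemma empty_exists: "\<exists>z. is_empty z"
  using inductive_exists unfolding is_inductive_def by blast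

lemma is_upair_unique: "\<lbrakk>is_upair x y u; is_upair x y v\<rbrakk> \<Longrightarrow> u = v"
  by (rule extensionality) (simp add: is_upair_def)

section \<open>Ordered pairs and functions\<close>

lemma is_pair_exists: "\<exists>p. is_pair x y p"
  unfolding is_pair_def using upair_exists by blast

lemma is_pair_unique: "\<lbrakk>is_pair x y p; is_pair x y q\<rbrakk> \<Longrightarrow> p = q"
  unfolding is_pair_def using is_upair_unique by metis

lemma is_pair_inject:
  assumes "is_pair x y p" "is_pair x' y' p"
  shows "x = x' \<and> y = y'"
proof -
  obtain u v where u: "is_upair x x u" "is_upair x y v" "is_upair u v p"
    using assms(1) unfolding is_pair_def by blast
  obtain u' v' where u': "is_upair x' x' u'" "is_upair x' y' v'" "is_upair u' v' p"
    using assms(2) unfolding is_pair_def by blast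
  have "z = u \<or> z = v \<longleftrightarrow> z = u' \<or> z = v'" for z
    using u(3) u'(3) by (simp add: is_upair_def)
  then have "u = u' \<or> u = v'" "v = u' \<or> v = v'" "u' = u \<or> u' = v" "v' = u \<or> v' = v"
    by blast+
  moreover have "\<And>z. z \<^bold>\<in> u \<longleftrightarrow> z = x" "\<And>z. z \<^bold>\<in> u' \<longleftrightarrow> z = x'"
    "\<And>z. z \<^bold>\<in> v \<longleftrightarrow> z = x \<or> z = y" "\<And>z. z \<^bold>\<in> v' \<longleftrightarrow> z = x' \<or> z = y'"
    using u u' unfolding is_upair_def by auto
  ultimately show ?thesis by metis
qed

lemma holds_iff: "is_pair x y p \<Longrightarrow> holds r x y \<longleftrightarrow> p \<^bold>\<in> r"
  unfolding holds_def using is_pair_unique by blast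

lemma function_onD:
  assumes "function_on f X"
  shows "holds f x y \<Longrightarrow> x \<^bold>\<in> X"
    and "\<lbrakk>holds f x y; holds f x y'\<rbrakk> \<Longrightarrow> y = y'"
    and "x \<^bold>\<in> X \<Longrightarrow> \<exists>y. holds f x y"
proof -
  show X: "x \<^bold>\<in> X" if "holds f x y" for x y
    using assms that is_pair_inject unfolding function_on_def holds_def by blast
  show "y = y'" if "holds f x y" "holds f x y'"
    using assms that X[OF that(1)] unfolding function_on_def by blast
  show "\<exists>y. holds f x y" if "x \<^bold>\<in> X"
    using assms that unfolding function_on_def by blast
qed

lemma function_from_toD:
  assumes "function_from_to f X Y"
  shows "function_on f X" "holds f x y \<Longrightarrow> x \<^bold>\<in> X" "holds f x y \<Longrightarrow> y \<^bold>\<in> Y"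
    "\<lbrakk>holds f x y; holds f x y'\<rbrakk> \<Longrightarrow> y = y'"
    "x \<^bold>\<in> X \<Longrightarrow> \<exists>y. holds f x y"
  using assms function_onD unfolding function_from_to_def by blast+

lemma function_ext:
  assumes "function_on f X" "function_on g Y" "\<And>x y. holds f x y \<longleftrightarrow> holds g x y"
  shows "f = g"
proof (rule extensionality)
  fix p
  have "p \<^bold>\<in> f \<Longrightarrow> \<exists>x y. is_pair x y p" "p \<^bold>\<in> g \<Longrightarrow> \<exists>x y. is_pair x y p"
    using assms(1,2) unfolding function_on_def by blast+
  then show "p \<^bold>\<in> f \<longleftrightarrow> p \<^bold>\<in> g"
    using assms(3) holds_iff by blast
qed

lemma function_from_toI:
  "\<lbrakk>function_on f X; \<And>x y. holds f x y \<Longrightarrow> y \<^bold>\<in> Y\<rbrakk> \<Longrightarrow> function_from_to f X Y"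
  unfolding function_from_to_def by blast

lemma function_exists:
  assumes def: "definable (\<lambda>e. G (e (Suc 0)) (e 0))"
    and ex: "\<And>x. x \<^bold>\<in> X \<Longrightarrow> \<exists>!y. G x y"
  shows "\<exists>f. function_on f X \<and> (\<forall>x y. holds f x y \<longleftrightarrow> x \<^bold>\<in> X \<and> G x y)"
proof -
  have "definable (\<lambda>e. \<exists>y. G (e 0) y \<and> is_pair (e 0) y (e (Suc 0)))"
    by (rule def | rule definable_basic tm_intros)+
  then have "\<exists>f. \<forall>p. p \<^bold>\<in> f \<longleftrightarrow> (\<exists>x. x \<^bold>\<in> X \<and> (\<exists>y. G x y \<and> is_pair x y p))"
    by (rule replacement) (use ex is_pair_unique in blast)
  then obtain f where f: "\<And>p. p \<^bold>\<in> f \<longleftrightarrow> (\<exists>x. x \<^bold>\<in> X \<and> (\<exists>y. G x y \<and> is_pair x y p))"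
    by blast
  have holds: "holds f x y \<longleftrightarrow> x \<^bold>\<in> X \<and> G x y" for x y
  proof -
    obtain p where "is_pair x y p" using is_pair_exists by blast
    then show ?thesis using f is_pair_inject holds_iff by metis
  qed
  have "function_on f X"
    unfolding function_on_def holds using f ex by blast
  then show ?thesis using holds by blast
qed

lemma bijectionD:
  assumes "bijection f X Y"
  shows "function_from_to f X Y"
    "\<lbrakk>holds f x y; holds f x' y\<rbrakk> \<Longrightarrow> x = x'"
    "y \<^bold>\<in> Y \<Longrightarrow> \<exists>x. holds f x y"
  using assms function_from_toD(3) unfolding bijection_def by blast+

section \<open>Natural numbers of the model\<close>

lemma natural_induct:
  assumes def: "definable (\<lambda>e. P (e 0))"
    and "natural n"
    and zero: "\<And>z. is_empty z \<Longrightarrow> P z"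
    and succ: "\<And>x y. \<lbrakk>P x; is_succ x y\<rbrakk> \<Longrightarrow> P y"
  shows "P n"
proof -
  obtain w where w: "is_inductive w" using inductive_exists by blast
  obtain u where u: "\<And>z. z \<^bold>\<in> u \<longleftrightarrow> z \<^bold>\<in> w \<and> P z" using separation[OF def] by metis
  \<comment> \<open>Only the part of an inductive set cut out by \<open>P\<close> has to be
    inductive; definability of \<open>P\<close> makes that part a set of the model.\<close>
  have "is_inductive u"
    using w zero succ unfolding is_inductive_def u by blast
  then show ?thesis using \<open>natural n\<close> u unfolding natural_def by blast
qed

text \<open>Since \<open>n\<close> may be nonstandard, extreme indices come from induction inside
  the model. A subset of the successor of \<open>m\<close> is either \<open>{m}\<close> or meets
  \<open>m\<close> in a nonempty \<open>Z\<close>; the minimum of \<open>Z\<close> stays minimal,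
  and the maximum is \<open>m\<close> if \<open>m\<close> belongs to the subset.\<close>

lemma natural_subset_min_max:
  assumes "natural n" "sub X n" "x \<^bold>\<in> X"
  shows "\<exists>i. i \<^bold>\<in> X \<and> (\<forall>j. j \<^bold>\<in> X \<longrightarrow> j = i \<or> i \<^bold>\<in> j)"
    and "\<exists>i. i \<^bold>\<in> X \<and> (\<forall>j. j \<^bold>\<in> X \<longrightarrow> j = i \<or> j \<^bold>\<in> i)"
proof -
  let ?min = "\<lambda>X. \<exists>i. i \<^bold>\<in> X \<and> (\<forall>j. j \<^bold>\<in> X \<longrightarrow> j = i \<or> i \<^bold>\<in> j)"
  let ?max = "\<lambda>X. \<exists>i. i \<^bold>\<in> X \<and> (\<forall>j. j \<^bold>\<in> X \<longrightarrow> j = i \<or> j \<^bold>\<in> i)"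
  have "\<forall>X. sub X n \<and> (\<exists>x. x \<^bold>\<in> X) \<longrightarrow> ?min X \<and> ?max X"
  proof (rule natural_induct[where P = "\<lambda>n. \<forall>X. sub X n \<and> (\<exists>x. x \<^bold>\<in> X) \<longrightarrow> ?min X \<and> ?max X"])
    show "definable (\<lambda>e. \<forall>X. sub X (e 0) \<and> (\<exists>x. x \<^bold>\<in> X) \<longrightarrow> ?min X \<and> ?max X)"
      by (rule definable_basic tm_intros)+
    show "natural n" by fact
  next
    fix z assume "is_empty z"
    then show "\<forall>X. sub X z \<and> (\<exists>x. x \<^bold>\<in> X) \<longrightarrow> ?min X \<and> ?max X"
      unfolding is_empty_def sub_def by blast
  next
    fix m k assume IH: "\<forall>X. sub X m \<and> (\<exists>x. x \<^bold>\<in> X) \<longrightarrow> ?min X \<and> ?max X" and k: "is_succ m k"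
    show "\<forall>X. sub X k \<and> (\<exists>x. x \<^bold>\<in> X) \<longrightarrow> ?min X \<and> ?max X"
    proof (intro allI impI)
      fix X assume X: "sub X k \<and> (\<exists>x. x \<^bold>\<in> X)"
      then have Xm: "x \<^bold>\<in> X \<Longrightarrow> x \<^bold>\<in> m \<or> x = m" for x
        using k unfolding is_succ_def sub_def by blast
      have "definable (\<lambda>e. e 0 \<^bold>\<in> m)"
        by (rule definable_basic tm_intros)+
      then obtain Z where Z: "\<And>x. x \<^bold>\<in> Z \<longleftrightarrow> x \<^bold>\<in> X \<and> x \<^bold>\<in> m"
        using separation[of "\<lambda>x. x \<^bold>\<in> m"] by metis
      show "?min X \<and> ?max X"
      proof (cases "\<exists>x. x \<^bold>\<in> Z")
        case False
        then have "\<And>x. x \<^bold>\<in> X \<longleftrightarrow> x = m" using X Xm Z by blast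
        then show ?thesis by blast
      next
        case True
        have "sub Z m" using Z unfolding sub_def by blast
        then have IH: "?min Z" "?max Z" using IH True by blast+
        have "?min X" using IH(1) Xm Z by metis
        moreover have "?max X"
        proof (cases "m \<^bold>\<in> X")
          case True then show ?thesis using Xm by blast
        next
          case False then show ?thesis using IH(2) Xm Z by metis
        qed
        ultimately show ?thesis by blast
      qed
    qed
  qed
  then show "?min X" "?max X" using assms(2,3) by blast+
qed

end

subsection \<open>The colouring\<close>

text \<open>\<open>S\<close> plays the role of the set of all copies of \<open>B\<close> in
  \<open>A\<close>; the isomorphism type enters only through the pigeonhole principle for two pieces
  and through \<open>nontrivial\<close>. The converse order \<open>gt\<close> is an element of the
  model, so both orders can be handled by the same lemmas.\<close>

locale ordered_copies = zf_universe mem for mem :: "'v \<Rightarrow> 'v \<Rightarrow> bool" (infix "\<^bold>\<in>" 50) +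
  fixes A S lt gt n r :: 'v
  assumes S_sub: "K \<^bold>\<in> S \<Longrightarrow> sub K A"
    and pigeon: "\<lbrakk>K \<^bold>\<in> S; \<forall>x. x \<^bold>\<in> K \<longleftrightarrow> x \<^bold>\<in> X \<or> x \<^bold>\<in> Y; \<forall>x. \<not> (x \<^bold>\<in> X \<and> x \<^bold>\<in> Y)\<rbrakk>
      \<Longrightarrow> X \<^bold>\<in> S \<or> Y \<^bold>\<in> S"
    and lt: "is_linear_order lt A"
    and gt: "holds gt x y \<longleftrightarrow> holds lt y x"
    and nat: "natural n"
    and nontrivial: "K \<^bold>\<in> S \<Longrightarrow>
      \<exists>t s. increasing_tuple lt n K t \<and> increasing_tuple lt n K s \<and> t \<^bold>\<in> r \<and> \<not> s \<^bold>\<in> r"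
begin

definition ord :: "'v \<Rightarrow> bool" where
  "ord \<sigma> \<longleftrightarrow> \<sigma> = lt \<or> \<sigma> = gt"

definition good :: "'v \<Rightarrow> 'v \<Rightarrow> bool" where
  "good \<sigma> K \<longleftrightarrow> \<not> (\<exists>b K'. b \<^bold>\<in> K \<and> K' \<^bold>\<in> S \<and> (\<forall>x. x \<^bold>\<in> K' \<longrightarrow> x \<^bold>\<in> K \<and> holds \<sigma> x b))"

text \<open>For an increasing tuple \<open>t\<close> in \<open>K\<close> this says that its entries
  form an initial segment of \<open>K\<close>. If \<sigma> is \<open>gt\<close>, this is a final
  segment for \<open>lt\<close>, but the tuple itself is still listed in
  \<open>lt\<close>-increasing order.\<close>

definition begins :: "'v \<Rightarrow> 'v \<Rightarrow> 'v \<Rightarrow> bool" where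
  "begins \<sigma> K t \<longleftrightarrow>
    (\<forall>x. x \<^bold>\<in> K \<longrightarrow> (\<exists>i. holds t i x) \<or> (\<forall>i y. holds t i y \<longrightarrow> holds \<sigma> y x))"

definition marked :: "'v \<Rightarrow> 'v \<Rightarrow> bool" where
  "marked \<sigma> K \<longleftrightarrow> (\<exists>t. t \<^bold>\<in> r \<and> increasing_tuple lt n K t \<and> begins \<sigma> K t)"

definition has_least :: "'v \<Rightarrow> 'v \<Rightarrow> bool" where
  "has_least \<sigma> K \<longleftrightarrow> (\<exists>m. m \<^bold>\<in> K \<and> (\<forall>x. x \<^bold>\<in> K \<longrightarrow> x = m \<or> holds \<sigma> m x))"

definition colour :: "'v \<Rightarrow> bool" where
  "colour K \<longleftrightarrow>
    (good lt K \<and> marked lt K) \<or>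
    (\<not> good lt K \<and> good gt K \<and> marked gt K) \<or>
    (\<not> good lt K \<and> \<not> good gt K \<and> (has_least lt K \<or> has_least gt K))"

lemma definable_colour: "tm T \<Longrightarrow> definable (\<lambda>e. colour (T e))"
  unfolding colour_def good_def begins_def marked_def has_least_def
  by (assumption | rule definable_basic definable_increasing_tuple tm_intros)+

section \<open>The two orders and increasing tuples\<close>

lemma ord_simps: "ord lt" "ord gt"
  by (simp_all add: ord_def)

lemma lt_irrefl: "\<not> holds lt x x"
  and lt_trans: "\<lbrakk>holds lt x y; holds lt y z\<rbrakk> \<Longrightarrow> holds lt x z"
  and lt_total: "\<lbrakk>x \<^bold>\<in> A; y \<^bold>\<in> A\<rbrakk> \<Longrightarrow> holds lt x y \<or> x = y \<or> holds lt y x"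
  using lt unfolding is_linear_order_def by blast+

lemma ord_irrefl: "ord \<sigma> \<Longrightarrow> \<not> holds \<sigma> x x"
  using lt_irrefl by (auto simp: ord_def gt)

lemma ord_trans: "\<lbrakk>ord \<sigma>; holds \<sigma> x y; holds \<sigma> y z\<rbrakk> \<Longrightarrow> holds \<sigma> x z"
  using lt_trans[of x y z] lt_trans[of z y x] by (auto simp: ord_def gt)

lemma ord_total: "\<lbrakk>ord \<sigma>; x \<^bold>\<in> A; y \<^bold>\<in> A\<rbrakk> \<Longrightarrow> holds \<sigma> x y \<or> x = y \<or> holds \<sigma> y x"
  using lt_total[of x y] by (auto simp: ord_def gt)

lemma split_copy [consumes 2, case_names inside outside]:
  assumes "K \<^bold>\<in> S" "definable (\<lambda>e. P (e 0))"
  obtains X where "X \<^bold>\<in> S" "\<And>x. x \<^bold>\<in> X \<longleftrightarrow> x \<^bold>\<in> K \<and> P x"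
  | X where "X \<^bold>\<in> S" "\<And>x. x \<^bold>\<in> X \<longleftrightarrow> x \<^bold>\<in> K \<and> \<not> P x"
proof -
  obtain X where X: "\<And>x. x \<^bold>\<in> X \<longleftrightarrow> x \<^bold>\<in> K \<and> P x"
    using separation[OF assms(2)] by metis
  obtain Y where Y: "\<And>x. x \<^bold>\<in> Y \<longleftrightarrow> x \<^bold>\<in> K \<and> \<not> P x"
    using separation[OF definable_not[OF assms(2)]] by metis
  have "X \<^bold>\<in> S \<or> Y \<^bold>\<in> S"
    by (rule pigeon[OF assms(1)]) (use X Y in blast)+
  then show thesis using that X Y by blast
qed

lemma increasing_tupleD:
  assumes "increasing_tuple lt n K t"
  shows "function_from_to t n K" "\<lbrakk>i \<^bold>\<in> j; holds t i x; holds t j y\<rbrakk> \<Longrightarrow> holds lt x y"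
  using assms unfolding increasing_tuple_def by blast+

text \<open>The least index serves for \<open>lt\<close>, the greatest for \<open>gt\<close>. The
  index depends on \<open>X\<close> and \<sigma> alone, so it works for two tuples
  simultaneously.\<close>

lemma index_extreme:
  assumes "ord \<sigma>" "sub X n" "x \<^bold>\<in> X"
  obtains i where "i \<^bold>\<in> X"
    "\<And>j K t y z. \<lbrakk>j \<^bold>\<in> X; j \<noteq> i; increasing_tuple lt n K t; holds t i y; holds t j z\<rbrakk> \<Longrightarrow> holds \<sigma> y z"
proof (cases "\<sigma> = lt")
  case True
  obtain i where i: "i \<^bold>\<in> X" "\<And>j. j \<^bold>\<in> X \<Longrightarrow> j = i \<or> i \<^bold>\<in> j"
    using natural_subset_min_max(1)[OF nat assms(2,3)] by blast
  show thesis
    by (rule that[OF i(1)]) (use i(2) increasing_tupleD(2) True in blast)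
next
  case False
  then have \<sigma>: "\<sigma> = gt" using assms(1) by (simp add: ord_def)
  obtain i where i: "i \<^bold>\<in> X" "\<And>j. j \<^bold>\<in> X \<Longrightarrow> j = i \<or> j \<^bold>\<in> i"
    using natural_subset_min_max(2)[OF nat assms(2,3)] by blast
  show thesis
    by (rule that[OF i(1)]) (use i(2) increasing_tupleD(2) in \<open>unfold \<sigma> gt, blast\<close>)
qed

lemma ord_converse:
  assumes "ord \<sigma>"
  obtains \<tau> where "ord \<tau>" "\<And>x y. holds \<tau> x y \<longleftrightarrow> holds \<sigma> y x"
  using assms gt unfolding ord_def by blast

lemma tuples_differ:
  assumes "increasing_tuple lt n K t" "increasing_tuple lt n K s" "t \<noteq> s"
  obtains i y z where "i \<^bold>\<in> n" "holds t i y" "holds s i z" "y \<noteq> z"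
proof -
  note t = function_from_toD[OF increasing_tupleD(1)[OF assms(1)]]
    and s = function_from_toD[OF increasing_tupleD(1)[OF assms(2)]]
  obtain i x where ix: "holds t i x \<noteq> holds s i x"
    using function_ext[OF t(1) s(1)] assms(3) by blast
  then have i: "i \<^bold>\<in> n" using t(2) s(2) by blast
  then obtain y z where "holds t i y" "holds s i z" using t(5) s(5) by blast
  moreover from this have "y \<noteq> z" using ix t(4) s(4) by blast
  ultimately show thesis using that i by blast
qed

text \<open>Two increasing tuples on which \<open>r\<close> disagrees are distinct, hence have
  distinct entries at some index.\<close>

lemma two_elements:
  assumes "K \<^bold>\<in> S"
  obtains x y where "x \<^bold>\<in> K" "y \<^bold>\<in> K" "holds lt x y"
proof -
  obtain t s where t: "increasing_tuple lt n K t" "t \<^bold>\<in> r"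
    and s: "increasing_tuple lt n K s" "\<not> s \<^bold>\<in> r"
    using nontrivial[OF assms] by blast
  then have ts: "increasing_tuple lt n K t" "increasing_tuple lt n K s" "t \<noteq> s" by auto
  obtain i y z where "holds t i y" "holds s i z" "y \<noteq> z"
    by (rule tuples_differ[OF ts])
  moreover from this have "y \<^bold>\<in> K" "z \<^bold>\<in> K"
    using function_from_toD(3) increasing_tupleD(1) ts by blast+
  ultimately show thesis
    using that lt_total S_sub[OF assms] unfolding sub_def by blast
qed

text \<open>Take the \<sigma>-extreme index \<open>i\<close> at which the tuples differ. The smaller
  of the two entries there must also occur in the other tuple, at an index where the tuples differ
  again, and this contradicts the choice of \<open>i\<close>.\<close>

lemma begins_unique:
  assumes \<sigma>: "ord \<sigma>"
    and t: "increasing_tuple lt n K t" "begins \<sigma> K t"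
    and s: "increasing_tuple lt n K s" "begins \<sigma> K s"
    and "sub K A"
  shows "t = s"
proof (rule ccontr)
  assume "t \<noteq> s"
  note ft = function_from_toD[OF increasing_tupleD(1)[OF t(1)]]
    and fs = function_from_toD[OF increasing_tupleD(1)[OF s(1)]]
  have "definable (\<lambda>e. \<exists>y z. holds t (e 0) y \<and> holds s (e 0) z \<and> y \<noteq> z)"
    by (rule definable_basic tm_intros)+
  then obtain X where X: "\<And>i. i \<^bold>\<in> X \<longleftrightarrow> i \<^bold>\<in> n \<and> (\<exists>y z. holds t i y \<and> holds s i z \<and> y \<noteq> z)"
    using separation[of "\<lambda>i. \<exists>y z. holds t i y \<and> holds s i z \<and> y \<noteq> z" n] by blast
  obtain k where k: "k \<^bold>\<in> X"
    by (rule tuples_differ[OF t(1) s(1) \<open>t \<noteq> s\<close>], rule that) (unfold X, blast)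
  have "sub X n" using X unfolding sub_def by blast
  obtain i where i: "i \<^bold>\<in> X"
    "\<And>j K t y z. \<lbrakk>j \<^bold>\<in> X; j \<noteq> i; increasing_tuple lt n K t; holds t i y; holds t j z\<rbrakk> \<Longrightarrow> holds \<sigma> y z"
    by (rule index_extreme[OF \<sigma> \<open>sub X n\<close> k], rule that; blast)
  \<comment> \<open>Stated for \<open>u\<close> and \<open>v\<close> because either of
    \<open>t\<close> and \<open>s\<close> may have the smaller entry at \<open>i\<close>.\<close>
  have step: False
    if u: "increasing_tuple lt n K u" "increasing_tuple lt n K v" "begins \<sigma> K v"
      and yz: "holds u i y" "holds v i z" "holds \<sigma> y z"
      and uv: "\<And>j y z. \<lbrakk>holds u j y; holds v j z; y \<noteq> z\<rbrakk> \<Longrightarrow> j \<^bold>\<in> X" for u v y z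
  proof -
    note fu = function_from_toD[OF increasing_tupleD(1)[OF u(1)]]
      and fv = function_from_toD[OF increasing_tupleD(1)[OF u(2)]]
    have "\<not> holds \<sigma> z y" using yz(3) ord_irrefl[OF \<sigma>] ord_trans[OF \<sigma>] by blast
    \<comment> \<open>As \<open>v\<close> begins \<open>K\<close>, the element \<open>y\<close> is
      an entry of \<open>v\<close> or lies above all of them; the latter fails for the entry
      \<open>z\<close>.\<close>
    then obtain j where j: "holds v j y"
      using u(3) fu(3)[OF yz(1)] yz(2) unfolding begins_def by blast
    have ji: "j \<noteq> i" using j yz ord_irrefl[OF \<sigma>] fv(4) by blast
    obtain y' where y': "holds u j y'" using fv(2)[OF j] fu(5) by blast
    have "j \<^bold>\<in> X"
    proof (rule ccontr)
      assume "\<not> j \<^bold>\<in> X"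
      then have uj: "holds u j y" using uv[OF y' j] y' by blast
      \<comment> \<open>Otherwise \<open>u\<close> takes the value \<open>y\<close> at both
        \<open>i\<close> and \<open>j\<close>. Comparing these two indices by
        \<open>index_extreme\<close> gives \<open>y\<close> strictly below itself.\<close>
      have "definable (\<lambda>e. e 0 = i \<or> e 0 = j)"
        by (rule definable_basic tm_intros)+
      then obtain Z where Z: "\<And>k. k \<^bold>\<in> Z \<longleftrightarrow> k \<^bold>\<in> n \<and> (k = i \<or> k = j)"
        using separation[of "\<lambda>k. k = i \<or> k = j" n] by blast
      then have Zn: "sub Z n" "i \<^bold>\<in> Z" "j \<^bold>\<in> Z"
        using fu(2) yz(1) y' unfolding sub_def by blast+
      obtain k where k: "k \<^bold>\<in> Z"
        "\<And>l K t y z. \<lbrakk>l \<^bold>\<in> Z; l \<noteq> k; increasing_tuple lt n K t; holds t k y; holds t l z\<rbrakk> \<Longrightarrow> holds \<sigma> y z"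
        by (rule index_extreme[OF \<sigma> Zn(1,2)], rule that; blast)
      have "k = i \<or> k = j" using k(1) Z by blast
      then have "holds \<sigma> y y"
        using k(2)[OF \<open>j \<^bold>\<in> Z\<close> _ u(1) _ uj] k(2)[OF \<open>i \<^bold>\<in> Z\<close> _ u(1) _ yz(1)] uj yz(1) ji by auto
      then show False using ord_irrefl[OF \<sigma>] by blast
    qed
    then have "holds \<sigma> z y" using i(2) ji u(2) yz(2) j by blast
    then show False using \<open>\<not> holds \<sigma> z y\<close> by blast
  qed
  obtain y z where yz: "holds t i y" "holds s i z" "y \<noteq> z" using i(1) X by blast
  then have "holds \<sigma> y z \<or> holds \<sigma> z y"
    using ord_total[OF \<sigma>, of y z] ft(3) fs(3) \<open>sub K A\<close> unfolding sub_def by blast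
  then show False
  proof
    assume "holds \<sigma> y z"
    show False
      by (rule step[OF t(1) s yz(1,2) \<open>holds \<sigma> y z\<close>]) (use X ft(2) in blast)
  next
    assume "holds \<sigma> z y"
    show False
      by (rule step[OF s(1) t yz(2,1) \<open>holds \<sigma> z y\<close>]) (use X ft(2) in blast)
  qed
qed

section \<open>Good copies\<close>

lemma good_sub: "\<lbrakk>good \<sigma> K; sub K' K\<rbrakk> \<Longrightarrow> good \<sigma> K'"
  unfolding good_def sub_def by blast

lemma good_begins:
  assumes \<sigma>: "ord \<sigma>" and K: "K \<^bold>\<in> S" "good \<sigma> K" and t: "increasing_tuple lt n K t"
  obtains X where "X \<^bold>\<in> S" "sub X K" "increasing_tuple lt n X t" "begins \<sigma> X t"
proof -
  note ft = function_from_toD[OF increasing_tupleD(1)[OF t(1)]]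
  let ?P = "\<lambda>x. (\<exists>i. holds t i x) \<or> (\<forall>i y. holds t i y \<longrightarrow> holds \<sigma> y x)"
  have "definable (\<lambda>e. ?P (e 0))"
    by (rule definable_basic tm_intros)+
  from K(1) this show thesis
  proof (cases rule: split_copy[where P = ?P])
    case (inside X)
    have "increasing_tuple lt n X t"
      using t inside(2) unfolding increasing_tuple_def function_from_to_def by blast
    then show thesis
      using that inside unfolding sub_def begins_def by blast
  next
    \<comment> \<open>This piece lies below the \<sigma>-last entry \<open>b\<close> of
      \<open>t\<close>, which goodness of \<open>K\<close> forbids. The entry \<open>b\<close> is
      found as the first one for the converse order \<tau>.\<close>
    case (outside X)
    obtain \<tau> where \<tau>: "ord \<tau>" "\<And>x y. holds \<tau> x y \<longleftrightarrow> holds \<sigma> y x"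
      using ord_converse[OF \<sigma>] by blast
    obtain x0 where "x0 \<^bold>\<in> X" using two_elements[OF outside(1)] by blast
    \<comment> \<open>An element outside the first piece fails to be above some entry of
      \<open>t\<close>, so the tuple is not empty.\<close>
    then obtain i0 where i0: "i0 \<^bold>\<in> n" using outside(2) ft(2) by blast
    have "sub n n" unfolding sub_def by blast
    obtain i where i: "i \<^bold>\<in> n"
      "\<And>j K t y z. \<lbrakk>j \<^bold>\<in> n; j \<noteq> i; increasing_tuple lt n K t; holds t i y; holds t j z\<rbrakk> \<Longrightarrow> holds \<tau> y z"
      by (rule index_extreme[OF \<tau>(1) \<open>sub n n\<close> i0], rule that; blast)
    obtain b where b: "holds t i b" using ft(5)[OF i(1)] by blast
    have "x \<^bold>\<in> K \<and> holds \<sigma> x b" if "x \<^bold>\<in> X" for x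
    proof -
      obtain j y where j: "holds t j y" "\<not> holds \<sigma> y x" "x \<noteq> y" and xK: "x \<^bold>\<in> K"
        using \<open>x \<^bold>\<in> X\<close> outside(2) by blast
      then have "holds \<sigma> x y"
        using ord_total[OF \<sigma>, of x y] ft(3) S_sub[OF K(1)] unfolding sub_def by blast
      moreover have "y = b \<or> holds \<sigma> y b"
        using i(2)[OF ft(2)[OF j(1)] _ t b j(1)] \<tau>(2) ft(4) b j(1) by blast
      ultimately show ?thesis using xK ord_trans[OF \<sigma>] by blast
    qed
    then have False
      using K(2) ft(3)[OF b] outside(1) unfolding good_def by blast
    then show thesis ..
  qed
qed

text \<open>One copy is made to begin with a tuple in \<open>r\<close>, the other with a tuple
  outside \<open>r\<close>. By \<open>begins_unique\<close> no further tuple can mark the second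
  one.\<close>

lemma good_marked:
  assumes \<sigma>: "ord \<sigma>" and K: "K \<^bold>\<in> S" "good \<sigma> K"
  obtains X Y where "X \<^bold>\<in> S" "sub X K" "marked \<sigma> X" "Y \<^bold>\<in> S" "sub Y K" "\<not> marked \<sigma> Y"
proof -
  obtain t s where t: "increasing_tuple lt n K t" "t \<^bold>\<in> r"
    and s: "increasing_tuple lt n K s" "\<not> s \<^bold>\<in> r"
    using nontrivial[OF K(1)] by blast
  obtain X where X: "X \<^bold>\<in> S" "sub X K" "increasing_tuple lt n X t" "begins \<sigma> X t"
    using good_begins[OF \<sigma> K t(1)] by blast
  obtain Y where Y: "Y \<^bold>\<in> S" "sub Y K" "increasing_tuple lt n Y s" "begins \<sigma> Y s"
    using good_begins[OF \<sigma> K s(1)] by blast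
  have "marked \<sigma> X" using X t(2) unfolding marked_def by blast
  moreover have "\<not> marked \<sigma> Y"
    using begins_unique[OF \<sigma> Y(3,4) _ _ S_sub[OF Y(1)]] s(2) unfolding marked_def by blast
  ultimately show thesis using that X Y by blast
qed

section \<open>Endpoints of copies\<close>

lemma copy_with_endpoint:
  assumes "K \<^bold>\<in> S"
  obtains X where "X \<^bold>\<in> S" "sub X K" "has_least lt X \<or> has_least gt X"
proof -
  obtain x y where xy: "x \<^bold>\<in> K" "y \<^bold>\<in> K" "holds lt x y" using two_elements[OF assms] by blast
  then have "x \<noteq> y" using lt_irrefl by blast
  have "definable (\<lambda>e. holds lt (e 0) x \<or> e 0 = y)"
    by (rule definable_basic tm_intros)+
  from assms this show thesis
  proof (cases rule: split_copy[where P = "\<lambda>z. holds lt z x \<or> z = y"])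
    \<comment> \<open>Here \<open>y\<close> is the last element; in the other piece \<open>x\<close>
      is the first.\<close>
    case (inside X)
    then have "has_least gt X"
      using xy lt_trans unfolding has_least_def gt by blast
    then show thesis using that inside unfolding sub_def by blast
  next
    case (outside X)
    then have "has_least lt X"
      using xy \<open>x \<noteq> y\<close> lt_irrefl lt_total S_sub[OF assms] unfolding has_least_def sub_def by blast
    then show thesis using that outside unfolding sub_def by blast
  qed
qed

text \<open>The upward closure of \<open>X\<close> in \<open>K\<close> is recorded so that the lemma
  can be applied for both orders in succession.\<close>

lemma copy_without_least:
  assumes \<sigma>: "ord \<sigma>" and K: "K \<^bold>\<in> S" and no: "\<And>X. \<lbrakk>X \<^bold>\<in> S; sub X K\<rbrakk> \<Longrightarrow> \<not> good \<sigma> X"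
  obtains X where "X \<^bold>\<in> S" "sub X K" "\<not> has_least \<sigma> X"
    "\<forall>x y. x \<^bold>\<in> X \<and> y \<^bold>\<in> K \<and> holds \<sigma> x y \<longrightarrow> y \<^bold>\<in> X"
proof -
  let ?P = "\<lambda>b. \<exists>K'. K' \<^bold>\<in> S \<and> (\<forall>x. x \<^bold>\<in> K' \<longrightarrow> x \<^bold>\<in> K \<and> holds \<sigma> x b)"
  have "definable (\<lambda>e. ?P (e 0))"
    by (rule definable_basic tm_intros)+
  from K this show thesis
  proof (cases rule: split_copy[where P = ?P])
    case (inside X)
    have "\<not> has_least \<sigma> X"
    proof
      assume "has_least \<sigma> X"
      then obtain m where m: "m \<^bold>\<in> X" "\<And>x. x \<^bold>\<in> X \<Longrightarrow> x = m \<or> holds \<sigma> m x"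
        unfolding has_least_def by blast
      then obtain K' where K': "K' \<^bold>\<in> S" "\<And>x. x \<^bold>\<in> K' \<Longrightarrow> x \<^bold>\<in> K \<and> holds \<sigma> x m"
        using inside(2) by blast
      \<comment> \<open>A copy inside \<open>K'\<close> below some \<open>b\<close> in
        \<open>K'\<close> would put \<open>b\<close> into \<open>X\<close>, although
        \<open>b\<close> lies below the least element \<open>m\<close> of \<open>X\<close>.\<close>
      have "good \<sigma> K'"
        unfolding good_def
      proof safe
        fix b Z assume b: "b \<^bold>\<in> K'" and Z: "Z \<^bold>\<in> S" "\<forall>x. x \<^bold>\<in> Z \<longrightarrow> x \<^bold>\<in> K' \<and> holds \<sigma> x b"
        then have "b \<^bold>\<in> X" using inside(2) K'(2) by blast
        then show False
          using m(2) K'(2)[OF b] ord_irrefl[OF \<sigma>] ord_trans[OF \<sigma>] by blast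
      qed
      then show False using no K' unfolding sub_def by blast
    qed
    moreover have "\<forall>x y. x \<^bold>\<in> X \<and> y \<^bold>\<in> K \<and> holds \<sigma> x y \<longrightarrow> y \<^bold>\<in> X"
      using inside(2) ord_trans[OF \<sigma>] by blast
    ultimately show thesis using that inside unfolding sub_def by blast
  next
    case (outside X)
    have "good \<sigma> X" using outside unfolding good_def by blast
    then show thesis using no outside unfolding sub_def by blast
  qed
qed

text \<open>The second application, for \<open>gt\<close>, yields a \<open>Y\<close> that is closed
  downwards in \<open>X\<close> for \<open>lt\<close>. So a least element of \<open>Y\<close> would
  be least in \<open>X\<close>.\<close>

lemma copy_without_endpoints:
  assumes K: "K \<^bold>\<in> S" and no: "\<And>X \<sigma>. \<lbrakk>X \<^bold>\<in> S; sub X K; ord \<sigma>\<rbrakk> \<Longrightarrow> \<not> good \<sigma> X"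
  obtains X where "X \<^bold>\<in> S" "sub X K" "\<not> has_least lt X" "\<not> has_least gt X"
proof -
  obtain X where X: "X \<^bold>\<in> S" "sub X K" "\<not> has_least lt X"
  proof (rule copy_without_least[OF ord_simps(1) K])
    show "\<not> good lt Z" if "Z \<^bold>\<in> S" "sub Z K" for Z
      using no that ord_simps(1) by blast
  qed
  obtain Y where Y: "Y \<^bold>\<in> S" "sub Y X" "\<not> has_least gt Y"
    "\<forall>x y. x \<^bold>\<in> Y \<and> y \<^bold>\<in> X \<and> holds gt x y \<longrightarrow> y \<^bold>\<in> Y"
  proof (rule copy_without_least[OF ord_simps(2) X(1)])
    show "\<not> good gt Z" if "Z \<^bold>\<in> S" "sub Z X" for Z
      using no[of Z gt] that X(2) ord_simps unfolding sub_def by blast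
  qed
  have "\<not> has_least lt Y"
  proof
    assume "has_least lt Y"
    then obtain m where m: "m \<^bold>\<in> Y" "\<And>x. x \<^bold>\<in> Y \<Longrightarrow> x = m \<or> holds lt m x"
      unfolding has_least_def by blast
    have "x = m \<or> holds lt m x" if "x \<^bold>\<in> X" for x
      using lt_total[of x m] S_sub[OF X(1)] Y(2,4) m that unfolding sub_def gt by blast
    then show False using X(3) m(1) Y(2) unfolding has_least_def sub_def by blast
  qed
  moreover have "sub Y K" using X(2) Y(2) unfolding sub_def by blast
  ultimately show thesis using that Y by blast
qed

theorem both_colours:
  assumes H: "H \<^bold>\<in> S"
  obtains X Y where "X \<^bold>\<in> S" "sub X H" "colour X" "Y \<^bold>\<in> S" "sub Y H" "\<not> colour Y"
proof -
  have sub_trans: "\<lbrakk>sub X Y; sub Y Z\<rbrakk> \<Longrightarrow> sub X Z" for X Y Z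
    unfolding sub_def by blast
  \<comment> \<open>The cases follow the precedence of the clauses of \<open>colour\<close>: in each
    of them all copies that get compared are coloured by the same clause.\<close>
  consider K where "K \<^bold>\<in> S" "sub K H" "good lt K"
    | K where "K \<^bold>\<in> S" "sub K H" "good gt K" "\<And>X. \<lbrakk>X \<^bold>\<in> S; sub X H\<rbrakk> \<Longrightarrow> \<not> good lt X"
    | "\<And>X \<sigma>. \<lbrakk>X \<^bold>\<in> S; sub X H; ord \<sigma>\<rbrakk> \<Longrightarrow> \<not> good \<sigma> X"
    unfolding ord_def by blast
  then show thesis
  proof cases
    case (1 K)
    obtain X Y where XY: "X \<^bold>\<in> S" "sub X K" "marked lt X" "Y \<^bold>\<in> S" "sub Y K" "\<not> marked lt Y"
      using good_marked[OF ord_simps(1) 1(1,3)] by blast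
    then have "colour X" "\<not> colour Y"
      using good_sub[OF 1(3)] unfolding colour_def by blast+
    then show thesis using that XY sub_trans 1(2) by blast
  next
    case (2 K)
    obtain X Y where XY: "X \<^bold>\<in> S" "sub X K" "marked gt X" "Y \<^bold>\<in> S" "sub Y K" "\<not> marked gt Y"
      using good_marked[OF ord_simps(2) 2(1,3)] by blast
    then have "sub X H" "sub Y H" using sub_trans 2(2) by blast+
    moreover from this have "colour X" "\<not> colour Y"
      using XY good_sub[OF 2(3)] 2(4) unfolding colour_def by blast+
    ultimately show thesis using that XY by blast
  next
    case 3
    obtain X where X: "X \<^bold>\<in> S" "sub X H" "has_least lt X \<or> has_least gt X"
      using copy_with_endpoint[OF H] by blast
    obtain Y where Y: "Y \<^bold>\<in> S" "sub Y H" "\<not> has_least lt Y" "\<not> has_least gt Y"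
      using copy_without_endpoints[OF H 3] by blast
    have "colour X" "\<not> colour Y"
      using 3 X Y ord_simps unfolding colour_def by blast+
    then show thesis using that X Y by blast
  qed
qed

end

subsection \<open>Isomorphic structures\<close>

context zf_universe
begin

definition isomorphism :: "'a \<Rightarrow> 'a \<Rightarrow> 'a \<Rightarrow> 'a \<Rightarrow> 'a \<Rightarrow> 'a \<Rightarrow> 'a \<Rightarrow> bool" where
  "isomorphism f L ar X I Y J \<longleftrightarrow>
     bijection f X Y \<and>
     (\<forall>R n r r'. R \<^bold>\<in> L \<and> holds ar R n \<and> holds I R r \<and> holds J R r' \<longrightarrow>
       (\<forall>t s. function_from_to t n X \<and> function_from_to s n Y \<and>
          (\<forall>i x y. holds t i x \<and> holds f x y \<longrightarrow> holds s i y) \<longrightarrow>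
          (t \<^bold>\<in> r \<longleftrightarrow> s \<^bold>\<in> r')))"

lemma isomorphic_iff: "isomorphic L ar X I Y J \<longleftrightarrow> (\<exists>f. isomorphism f L ar X I Y J)"
  unfolding isomorphic_def isomorphism_def ..

lemma isomorphismD:
  assumes "isomorphism f L ar X I Y J"
  shows "bijection f X Y"
    "\<lbrakk>R \<^bold>\<in> L; holds ar R n; holds I R r; holds J R r'; function_from_to t n X; function_from_to s n Y;
      \<And>i x y. \<lbrakk>holds t i x; holds f x y\<rbrakk> \<Longrightarrow> holds s i y\<rbrakk> \<Longrightarrow> t \<^bold>\<in> r \<longleftrightarrow> s \<^bold>\<in> r'"
  using assms unfolding isomorphism_def by blast+

lemma bijection_exists:
  assumes def: "definable (\<lambda>e. G (e (Suc 0)) (e 0))"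
    and "\<And>x. x \<^bold>\<in> X \<Longrightarrow> \<exists>y. G x y"
    and "\<And>x y. \<lbrakk>x \<^bold>\<in> X; G x y\<rbrakk> \<Longrightarrow> y \<^bold>\<in> Y"
    and "\<And>y. y \<^bold>\<in> Y \<Longrightarrow> \<exists>x. x \<^bold>\<in> X \<and> G x y"
    and "\<And>x y y'. \<lbrakk>x \<^bold>\<in> X; G x y; G x y'\<rbrakk> \<Longrightarrow> y = y'"
    and "\<And>x x' y. \<lbrakk>x \<^bold>\<in> X; x' \<^bold>\<in> X; G x y; G x' y\<rbrakk> \<Longrightarrow> x = x'"
  obtains f where "bijection f X Y" "\<And>x y. holds f x y \<longleftrightarrow> x \<^bold>\<in> X \<and> G x y"
proof -
  obtain f where f: "function_on f X" "\<And>x y. holds f x y \<longleftrightarrow> x \<^bold>\<in> X \<and> G x y"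
    using function_exists[OF def, of X] assms(2,5) by blast
  have "bijection f X Y"
    unfolding bijection_def function_from_to_def f(2) using f(1) assms(3,4,6) by blast
  then show thesis using that f(2) by blast
qed

text \<open>The interpretations need not be cut down, since an isomorphism compares only tuples over
  the two underlying sets.\<close>

lemma isomorphism_restrict:
  assumes f: "isomorphism f L ar X I Y J" and "sub X' X"
    and Y': "\<And>y. y \<^bold>\<in> Y' \<longleftrightarrow> (\<exists>x. x \<^bold>\<in> X' \<and> holds f x y)"
  shows "isomorphic L ar X' I Y' J"
proof -
  note bij = bijectionD[OF isomorphismD(1)[OF f]]
  note ff = function_from_toD[OF bij(1)]
  have X': "x \<^bold>\<in> X' \<Longrightarrow> x \<^bold>\<in> X" for x using \<open>sub X' X\<close> unfolding sub_def by blast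
  have "definable (\<lambda>e. holds f (e (Suc 0)) (e 0))"
    by (rule definable_basic tm_intros)+
  then obtain g where g: "bijection g X' Y'" "\<And>x y. holds g x y \<longleftrightarrow> x \<^bold>\<in> X' \<and> holds f x y"
    by (rule bijection_exists[where X = X' and Y = Y']) (use X' Y' ff bij(2) in blast)+
  have "isomorphism g L ar X' I Y' J"
    unfolding isomorphism_def
  proof (intro conjI g(1) allI impI, elim conjE)
    fix R n r r' t s
    assume R: "R \<^bold>\<in> L" "holds ar R n" "holds I R r" "holds J R r'"
      and t: "function_from_to t n X'" and s: "function_from_to s n Y'"
      and ts: "\<forall>i x y. holds t i x \<and> holds g x y \<longrightarrow> holds s i y"
    show "t \<^bold>\<in> r \<longleftrightarrow> s \<^bold>\<in> r'"
    proof (rule isomorphismD(2)[OF f R])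
      show "function_from_to t n X" "function_from_to s n Y"
        using t s X' Y' ff(3) unfolding function_from_to_def by blast+
      show "holds s i y" if "holds t i x" "holds f x y" for i x y
        using that ts g(2) function_from_toD(3)[OF t] by blast
    qed
  qed
  then show ?thesis unfolding isomorphic_iff by blast
qed

lemma isomorphic_trans:
  assumes "isomorphic L ar X I Y J" "isomorphic L ar Y J Z K" "function_on J L"
  shows "isomorphic L ar X I Z K"
proof -
  obtain f g where f: "isomorphism f L ar X I Y J" and g: "isomorphism g L ar Y J Z K"
    using assms(1,2) unfolding isomorphic_iff by blast
  note bf = bijectionD[OF isomorphismD(1)[OF f]] and bg = bijectionD[OF isomorphismD(1)[OF g]]
  note ff = function_from_toD[OF bf(1)] and fg = function_from_toD[OF bg(1)]
  have "definable (\<lambda>e. \<exists>y. holds f (e (Suc 0)) y \<and> holds g y (e 0))"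
    by (rule definable_basic tm_intros)+
  then obtain h where h: "bijection h X Z"
    "\<And>x z. holds h x z \<longleftrightarrow> x \<^bold>\<in> X \<and> (\<exists>y. holds f x y \<and> holds g y z)"
  proof (rule bijection_exists[where X = X and Y = Z])
    show "\<exists>z y. holds f x y \<and> holds g y z" if "x \<^bold>\<in> X" for x
      using that ff(3,5) fg(5) by blast
    show "z \<^bold>\<in> Z" if "\<exists>y. holds f x y \<and> holds g y z" for x z
      using that fg(3) by blast
    show "\<exists>x. x \<^bold>\<in> X \<and> (\<exists>y. holds f x y \<and> holds g y z)" if "z \<^bold>\<in> Z" for z
      using that bg(3) bf(3) fg(2) ff(2) by blast
    show "z = z'" if "\<exists>y. holds f x y \<and> holds g y z" "\<exists>y. holds f x y \<and> holds g y z'" for x z z'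
      using that ff(4) fg(4) by blast
    show "x = x'" if "\<exists>y. holds f x y \<and> holds g y z" "\<exists>y. holds f x' y \<and> holds g y z" for x x' z
      using that bf(2) bg(2) by blast
  qed blast
  have "isomorphism h L ar X I Z K"
    unfolding isomorphism_def
  proof (intro conjI h(1) allI impI, elim conjE)
    fix R n r r' t s
    assume R: "R \<^bold>\<in> L" "holds ar R n" "holds I R r" "holds K R r'"
      and t: "function_from_to t n X" and s: "function_from_to s n Z"
      and ts: "\<forall>i x z. holds t i x \<and> holds h x z \<longrightarrow> holds s i z"
    note ft = function_from_toD[OF t]
    \<comment> \<open>The comparison of \<open>t\<close> with \<open>s\<close> passes through the
      tuple \<open>u\<close>, the composition of \<open>f\<close> with \<open>t\<close>; this
      requires an interpretation of \<open>R\<close> in the middle structure.\<close>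
    obtain q where q: "holds J R q" using function_onD(3)[OF assms(3) R(1)] by blast
    have "definable (\<lambda>e. \<exists>x. holds t (e (Suc 0)) x \<and> holds f x (e 0))"
      by (rule definable_basic tm_intros)+
    moreover have "\<exists>!y. \<exists>x. holds t i x \<and> holds f x y" if "i \<^bold>\<in> n" for i
      using ft(3,4) ft(5)[OF that] ff(4,5) by blast
    ultimately obtain u where u: "function_on u n"
      "\<And>i y. holds u i y \<longleftrightarrow> i \<^bold>\<in> n \<and> (\<exists>x. holds t i x \<and> holds f x y)"
      using function_exists[of "\<lambda>i y. \<exists>x. holds t i x \<and> holds f x y" n] by blast
    have uY: "function_from_to u n Y"
      by (rule function_from_toI[OF u(1)]) (use u(2) ff(3) in blast)
    have "t \<^bold>\<in> r \<longleftrightarrow> u \<^bold>\<in> q"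
      by (rule isomorphismD(2)[OF f R(1-3) q t uY]) (use u(2) ft(2) in blast)
    also have "u \<^bold>\<in> q \<longleftrightarrow> s \<^bold>\<in> r'"
      by (rule isomorphismD(2)[OF g R(1,2) q R(4) uY s]) (use u(2) ts h(2) ft(3) in blast)
    finally show "t \<^bold>\<in> r \<longleftrightarrow> s \<^bold>\<in> r'" .
  qed
  then show ?thesis unfolding isomorphic_iff by blast
qed

section \<open>Transfer of the pigeonhole property and of nontriviality to copies\<close>

lemma image_exists: "\<exists>v. \<forall>y. y \<^bold>\<in> v \<longleftrightarrow> (\<exists>x. x \<^bold>\<in> X \<and> holds f x y)"
  if "function_from_to f Y Z"
proof (rule replacement)
  show "definable (\<lambda>e. holds f (e 0) (e (Suc 0)))"
    by (rule definable_basic tm_intros)+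
qed (use function_from_toD(4)[OF that] in blast)

text \<open>The two pieces are a family indexed by 2, the successor of the natural number 1.\<close>

lemma pigeonhole_two:
  assumes "pigeonhole L ar B J" "\<forall>x. x \<^bold>\<in> B \<longleftrightarrow> x \<^bold>\<in> X \<or> x \<^bold>\<in> Y" "\<forall>x. \<not> (x \<^bold>\<in> X \<and> x \<^bold>\<in> Y)"
  shows "isomorphic L ar X J B J \<or> isomorphic L ar Y J B J"
proof -
  obtain zero where zero: "is_empty zero" using empty_exists by blast
  obtain one where one: "is_succ zero one" using succ_exists by blast
  obtain two where two: "is_succ one two" using succ_exists by blast
  have mem1: "z \<^bold>\<in> one \<longleftrightarrow> z = zero" for z
    using zero one unfolding is_empty_def is_succ_def by blast
  then have mem2: "z \<^bold>\<in> two \<longleftrightarrow> z = zero \<or> z = one" for z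
    using two unfolding is_succ_def by blast
  have neq: "zero \<noteq> one" using zero mem1 unfolding is_empty_def by blast
  have nat: "natural one"
    unfolding natural_def is_inductive_def
  proof (intro allI impI, elim conjE exE)
    fix w z assume "is_empty z" "z \<^bold>\<in> w" and w: "\<forall>x y. x \<^bold>\<in> w \<and> is_succ x y \<longrightarrow> y \<^bold>\<in> w"
    then have "z = zero"
      using zero by (intro extensionality) (simp add: is_empty_def)
    then show "one \<^bold>\<in> w" using w one \<open>z \<^bold>\<in> w\<close> by blast
  qed
  let ?G = "\<lambda>i V. (i = zero \<and> V = X) \<or> (i = one \<and> V = Y)"
  have "definable (\<lambda>e. ?G (e (Suc 0)) (e 0))"
    by (rule definable_basic tm_intros)+
  moreover have "\<exists>!V. ?G i V" if "i \<^bold>\<in> two" for i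
    using that mem2 neq by auto
  ultimately obtain P where P: "function_on P two" "\<And>i V. holds P i V \<longleftrightarrow> i \<^bold>\<in> two \<and> ?G i V"
    using function_exists[of ?G two] by blast
  have "is_partition P two B"
    unfolding is_partition_def P(2) mem2 using P(1) assms(2,3) by blast
  then obtain i V where "holds P i V" "isomorphic L ar V J B J"
    using assms(1) nat two unfolding pigeonhole_def by blast
  then show ?thesis using P(2) by auto
qed

text \<open>The splitting of \<open>K\<close> is carried over to \<open>B\<close>. Each piece is
  isomorphic to its image, one of the images is isomorphic to \<open>B\<close>, and the two
  isomorphisms compose.\<close>

lemma pigeonhole_copy:
  assumes B: "pigeonhole L ar B J" "function_on J L" and K: "isomorphic L ar K I B J"
    and XY: "\<forall>x. x \<^bold>\<in> K \<longleftrightarrow> x \<^bold>\<in> X \<or> x \<^bold>\<in> Y" "\<forall>x. \<not> (x \<^bold>\<in> X \<and> x \<^bold>\<in> Y)"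
  shows "isomorphic L ar X I B J \<or> isomorphic L ar Y I B J"
proof -
  obtain f where f: "isomorphism f L ar K I B J" using K unfolding isomorphic_iff by blast
  note bij = bijectionD[OF isomorphismD(1)[OF f]]
  note ff = function_from_toD[OF bij(1)]
  obtain X' where X': "\<And>y. y \<^bold>\<in> X' \<longleftrightarrow> (\<exists>x. x \<^bold>\<in> X \<and> holds f x y)"
    using image_exists[OF bij(1), of X] by blast
  obtain Y' where Y': "\<And>y. y \<^bold>\<in> Y' \<longleftrightarrow> (\<exists>x. x \<^bold>\<in> Y \<and> holds f x y)"
    using image_exists[OF bij(1), of Y] by blast
  have "y \<^bold>\<in> B \<longleftrightarrow> y \<^bold>\<in> X' \<or> y \<^bold>\<in> Y'" for y
    unfolding X' Y' using XY(1) bij(3) ff(2,3) by blast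
  moreover have "\<not> (y \<^bold>\<in> X' \<and> y \<^bold>\<in> Y')" for y
    unfolding X' Y' using XY(2) bij(2) by blast
  ultimately have "isomorphic L ar X' J B J \<or> isomorphic L ar Y' J B J"
    by (intro pigeonhole_two[OF B(1)]) blast+
  moreover have "isomorphic L ar X I X' J" "isomorphic L ar Y I Y' J"
    by (rule isomorphism_restrict[OF f _ X'] isomorphism_restrict[OF f _ Y'],
        use XY(1) in \<open>simp add: sub_def\<close>)+
  ultimately show ?thesis using isomorphic_trans B(2) by blast
qed

text \<open>The order of \<open>K\<close> is pushed forward along \<open>f\<close> to a linear order
  of \<open>B\<close>. This order does not trivialise \<open>R\<close>, and the two tuples
  witnessing so are pulled back to \<open>K\<close>.\<close>

lemma nontrivial_copy:
  assumes f: "isomorphism f L ar K I B J"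
    and R: "R \<^bold>\<in> L" "holds ar R n" "holds I R r" "holds J R r'"
    and fn: "function_on ar L" "function_on J L"
    and lt: "is_linear_order lt A" "sub K A"
    and no: "\<not> (\<exists>lt. is_linear_order lt B \<and> trivialises ar B J lt R)"
  shows "\<exists>t s. increasing_tuple lt n K t \<and> increasing_tuple lt n K s \<and> t \<^bold>\<in> r \<and> \<not> s \<^bold>\<in> r"
proof -
  note bij = bijectionD[OF isomorphismD(1)[OF f]]
  note ff = function_from_toD[OF bij(1)]
  have lt_irrefl: "\<not> holds lt x x"
    and lt_trans: "\<lbrakk>holds lt x y; holds lt y z\<rbrakk> \<Longrightarrow> holds lt x z"
    and lt_total: "\<lbrakk>x \<^bold>\<in> K; y \<^bold>\<in> K\<rbrakk> \<Longrightarrow> holds lt x y \<or> x = y \<or> holds lt y x" for x y z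
    using lt unfolding is_linear_order_def sub_def by blast+
  \<comment> \<open>Pairs of \<open>lt\<close> with a component outside \<open>K\<close> have no
    image, so only the order on \<open>K\<close> is transported.\<close>
  let ?Q = "\<lambda>p q. \<exists>x y x' y'. is_pair x y p \<and> holds f x x' \<and> holds f y y' \<and> is_pair x' y' q"
  have "\<exists>ltB. \<forall>q. q \<^bold>\<in> ltB \<longleftrightarrow> (\<exists>p. p \<^bold>\<in> lt \<and> ?Q p q)"
  proof (rule replacement)
    show "definable (\<lambda>e. ?Q (e 0) (e (Suc 0)))"
      by (rule definable_basic tm_intros)+
    fix p q q' assume "?Q p q" "?Q p q'"
    then show "q = q'" using is_pair_inject is_pair_unique ff(4) by metis
  qed
  then obtain ltB where ltB: "\<And>q. q \<^bold>\<in> ltB \<longleftrightarrow> (\<exists>p. p \<^bold>\<in> lt \<and> ?Q p q)" by blast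
  have holds_ltB: "holds ltB x' y' \<longleftrightarrow> (\<exists>x y. holds lt x y \<and> holds f x x' \<and> holds f y y')" for x' y'
  proof
    assume "holds ltB x' y'"
    then obtain q where q: "is_pair x' y' q" "q \<^bold>\<in> ltB"
      unfolding holds_def by blast
    then obtain p x y x'' y'' where p: "p \<^bold>\<in> lt" "is_pair x y p"
      "holds f x x''" "holds f y y''" "is_pair x'' y'' q"
      unfolding ltB by blast
    have "x'' = x' \<and> y'' = y'" by (rule is_pair_inject[OF p(5) q(1)])
    then show "\<exists>x y. holds lt x y \<and> holds f x x' \<and> holds f y y'"
      using p holds_iff by blast
  next
    assume "\<exists>x y. holds lt x y \<and> holds f x x' \<and> holds f y y'"
    then obtain x y where xy: "holds lt x y" "holds f x x'" "holds f y y'" by blast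
    obtain p where "is_pair x y p" "p \<^bold>\<in> lt" using xy(1) unfolding holds_def by blast
    moreover obtain q where "is_pair x' y' q" using is_pair_exists by blast
    ultimately show "holds ltB x' y'"
      using holds_iff[of x' y' q ltB] ltB[of q] xy(2,3) by blast
  qed
  have "is_linear_order ltB B"
    unfolding is_linear_order_def
  proof (intro conjI allI impI)
    show "\<exists>x y. x \<^bold>\<in> B \<and> y \<^bold>\<in> B \<and> is_pair x y q" if "q \<^bold>\<in> ltB" for q
      using that ff(3) unfolding ltB by blast
    show "\<not> holds ltB x x" for x
      unfolding holds_ltB using bij(2) lt_irrefl by blast
    show "holds ltB x z" if "holds ltB x y \<and> holds ltB y z" for x y z
      using that bij(2) lt_trans unfolding holds_ltB by metis
    show "holds ltB x y \<or> x = y \<or> holds ltB y x" if xy: "x \<^bold>\<in> B \<and> y \<^bold>\<in> B" for x y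
    proof -
      obtain x' y' where "holds f x' x" "holds f y' y" using bij(3) xy by blast
      then show ?thesis
        using lt_total[of x' y'] ff(2,4) unfolding holds_ltB by blast
    qed
  qed
  then have "\<not> trivialises ar B J ltB R" using no by blast
  then obtain t' s' where t': "increasing_tuple ltB n B t'" "t' \<^bold>\<in> r'"
    and s': "increasing_tuple ltB n B s'" "\<not> s' \<^bold>\<in> r'"
    unfolding trivialises_def
    using function_onD(2)[OF fn(1) R(2)] function_onD(2)[OF fn(2) R(4)] by blast
  have pull: "\<exists>t. increasing_tuple lt n K t \<and> (t \<^bold>\<in> r \<longleftrightarrow> t' \<^bold>\<in> r')"
    if t': "increasing_tuple ltB n B t'" for t'
  proof -
    have ft': "function_from_to t' n B"
      and inc: "\<And>i j x y. \<lbrakk>i \<^bold>\<in> j; holds t' i x; holds t' j y\<rbrakk> \<Longrightarrow> holds ltB x y"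
      using t' unfolding increasing_tuple_def by blast+
    note ft = function_from_toD[OF ft']
    have "definable (\<lambda>e. \<exists>y. holds t' (e (Suc 0)) y \<and> holds f (e 0) y)"
      by (rule definable_basic tm_intros)+
    moreover have "\<exists>!x. \<exists>y. holds t' i y \<and> holds f x y" if "i \<^bold>\<in> n" for i
      using ft(3,4) ft(5)[OF that] bij(2,3) by blast
    ultimately obtain t where t: "function_on t n"
      "\<And>i x. holds t i x \<longleftrightarrow> i \<^bold>\<in> n \<and> (\<exists>y. holds t' i y \<and> holds f x y)"
      using function_exists[of "\<lambda>i x. \<exists>y. holds t' i y \<and> holds f x y" n] by blast
    have tK: "function_from_to t n K"
      by (rule function_from_toI[OF t(1)]) (use t(2) ff(2) in blast)
    have "holds lt x y" if "i \<^bold>\<in> j" "holds t i x" "holds t j y" for i j x y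
      using that inc[OF that(1)] bij(2) unfolding t(2) holds_ltB by metis
    then have "increasing_tuple lt n K t" using tK unfolding increasing_tuple_def by blast
    moreover have "t \<^bold>\<in> r \<longleftrightarrow> t' \<^bold>\<in> r'"
      by (rule isomorphismD(2)[OF f R tK ft']) (use t(2) ff(4) in blast)
    ultimately show ?thesis by blast
  qed
  show ?thesis using pull[OF t'(1)] pull[OF s'(1)] t'(2) s'(2) by blast
qed

lemma converse_exists: "\<exists>gt. \<forall>x y. holds gt x y \<longleftrightarrow> holds lt y x"
proof -
  let ?Q = "\<lambda>p q. \<exists>x y. is_pair x y p \<and> is_pair y x q"
  have "\<exists>gt. \<forall>q. q \<^bold>\<in> gt \<longleftrightarrow> (\<exists>p. p \<^bold>\<in> lt \<and> ?Q p q)"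
  proof (rule replacement)
    show "definable (\<lambda>e. ?Q (e 0) (e (Suc 0)))"
      by (rule definable_basic tm_intros)+
    fix p q q' assume "?Q p q" "?Q p q'"
    then show "q = q'" using is_pair_inject is_pair_unique by metis
  qed
  then obtain gt where gt: "\<And>q. q \<^bold>\<in> gt \<longleftrightarrow> (\<exists>p. p \<^bold>\<in> lt \<and> ?Q p q)" by blast
  have "holds gt x y \<longleftrightarrow> holds lt y x" for x y
    unfolding holds_def gt using is_pair_inject is_pair_exists by metis
  then show ?thesis by blast
qed

theorem not_arrows:
  assumes lang: "rel_language L ar"
    and A: "rel_structure L ar A I" "is_linear_order lt A"
    and B: "rel_structure L ar B J" "pigeonhole L ar B J"
    and R: "R \<^bold>\<in> L" "\<not> (\<exists>lt. is_linear_order lt B \<and> trivialises ar B J lt R)"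
  shows "\<not> arrows L ar A I B J"
proof
  assume arrows: "arrows L ar A I B J"
  have fn: "function_on ar L" "function_on I L" "function_on J L"
    using lang A(1) B(1) unfolding rel_language_def rel_structure_def by blast+
  obtain n r r' where R': "holds ar R n" "holds I R r" "holds J R r'"
    using function_onD(3)[OF _ R(1)] fn by metis
  have nat: "natural n" using lang R'(1) unfolding rel_language_def by blast
  obtain U where U: "\<And>X. X \<^bold>\<in> U \<longleftrightarrow> sub X A" using power_exists by metis
  have "definable (\<lambda>e. isomorphic L ar (e 0) I B J)"
    by (rule definable_isomorphic tm_intros)+
  then obtain S where "\<And>X. X \<^bold>\<in> S \<longleftrightarrow> X \<^bold>\<in> U \<and> isomorphic L ar X I B J"
    using separation[of "\<lambda>X. isomorphic L ar X I B J" U] by blast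
  then have S: "X \<^bold>\<in> S \<longleftrightarrow> sub X A \<and> isomorphic L ar X I B J" for X
    using U by blast
  obtain gt where gt: "\<And>x y. holds gt x y \<longleftrightarrow> holds lt y x" using converse_exists by blast
  interpret ordered_copies mem A S lt gt n r
  proof
    show "sub K A" if "K \<^bold>\<in> S" for K using that S by blast
    show "X \<^bold>\<in> S \<or> Y \<^bold>\<in> S"
      if K: "K \<^bold>\<in> S" and XY: "\<forall>x. x \<^bold>\<in> K \<longleftrightarrow> x \<^bold>\<in> X \<or> x \<^bold>\<in> Y" "\<forall>x. \<not> (x \<^bold>\<in> X \<and> x \<^bold>\<in> Y)" for K X Y
    proof -
      have "isomorphic L ar X I B J \<or> isomorphic L ar Y I B J"
        using pigeonhole_copy[OF B(2) fn(3) _ XY] K S by blast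
      moreover have "sub X A" "sub Y A" using K S XY(1) unfolding sub_def by blast+
      ultimately show ?thesis using S by blast
    qed
    show "\<exists>t s. increasing_tuple lt n K t \<and> increasing_tuple lt n K s \<and> t \<^bold>\<in> r \<and> \<not> s \<^bold>\<in> r"
      if "K \<^bold>\<in> S" for K
    proof -
      have K: "sub K A" and "isomorphic L ar K I B J" using that S by blast+
      then obtain f where "isomorphism f L ar K I B J" unfolding isomorphic_iff by blast
      then show ?thesis by (rule nontrivial_copy[OF _ R(1) R' fn(1,3) A(2) K R(2)])
    qed
  qed (use A(2) gt nat in auto)
  obtain zero where zero: "is_empty zero" using empty_exists by blast
  obtain one where one: "is_succ zero one" using succ_exists by blast
  obtain two where two: "is_succ one two" using succ_exists by blast
  have neq: "zero \<noteq> one" using zero one unfolding is_empty_def is_succ_def by blast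
  let ?G = "\<lambda>K c. (colour K \<and> c = one) \<or> (\<not> colour K \<and> c = zero)"
  have "definable (\<lambda>e. ?G (e (Suc 0)) (e 0))"
    \<comment> \<open>Definability of \<open>colour\<close> is what turns it into a colouring
      \<open>F\<close> that is an element of the model.\<close>
    by (rule definable_colour definable_basic tm_intros)+
  then obtain F where F: "function_on F S" "\<And>K c. holds F K c \<longleftrightarrow> K \<^bold>\<in> S \<and> ?G K c"
    using function_exists[of ?G S] by blast
  have "function_from_to F S two"
    by (rule function_from_toI[OF F(1)]) (use F(2) one two in \<open>auto simp: is_succ_def\<close>)
  moreover have "is_set_of_copies L ar A I B J S"
    unfolding is_set_of_copies_def is_copy_def using S by blast
  moreover have "is_two two" using zero one two unfolding is_two_def by blast
  ultimately have "\<exists>H. H \<^bold>\<in> S \<and> (\<exists>T. is_set_of_copies L ar H I B J T \<and> (\<exists>c. \<forall>K. K \<^bold>\<in> T \<longrightarrow> holds F K c))"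
    using arrows[unfolded arrows_def, rule_format, of S two F] by blast
  then obtain H T c where H: "H \<^bold>\<in> S" and T: "is_set_of_copies L ar H I B J T"
    and c: "\<And>K. K \<^bold>\<in> T \<Longrightarrow> holds F K c"
    by blast
  obtain X Y where X: "X \<^bold>\<in> S" "sub X H" "colour X" and Y: "Y \<^bold>\<in> S" "sub Y H" "\<not> colour Y"
    by (rule both_colours[OF H])
  \<comment> \<open>Being a copy of \<open>B\<close> does not depend on the surrounding set, so
    copies in \<open>A\<close> that lie within \<open>H\<close> belong to \<open>T\<close>.\<close>
  have "X \<^bold>\<in> T" "Y \<^bold>\<in> T"
    using T X(1,2) Y(1,2) S unfolding is_set_of_copies_def is_copy_def by blast+
  then show False
    using c[of X] c[of Y] X(3) Y(3) neq unfolding F(2) by simp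
qed

end

theorem theorem17:
  fixes E :: "'v \<Rightarrow> 'v \<Rightarrow> bool"
    and L ar A I B J :: 'v
  assumes "universe.ZF E"
    and "universe.rel_language E L ar"
    and "universe.rel_structure E L ar A I"
    and "\<exists>lt. universe.is_linear_order E lt A"
    and "universe.rel_structure E L ar B J"
    and "universe.pigeonhole E L ar B J"
    and "\<exists>R. E R L \<and>
           \<not> (\<exists>lt. universe.is_linear_order E lt B \<and> universe.trivialises E ar B J lt R)"
    and "\<exists>H. universe.is_copy E L ar A I B J H"
  shows "\<not> universe.arrows E L ar A I B J"
proof -
  interpret zf_universe E
    using assms(1) by unfold_locales
  show ?thesis using assms not_arrows by blast
qed

end
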